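(* For each $k\in\{3,4,5\}$ there exists $N_0$ such that $\mathcal{B}(k,n)=\binom{k}{2}-1$ for all integers $n\ge N_0$.
   Context: An orthogonal array $\mathrm{OA}(k,n)$ on an alphabet $\Lambda$ with $|\Lambda|=n$ is an $n^2\times k$ matrix $A=(a_{r\ell})$ with entries in $\Lambda$ such that in every pair of distinct columns each ordered pair in $\Lambda^2$ occurs in exactly one row. For distinct columns $c,i,j\in\{1,\dots,k\}$ and $s\in\Lambda$, let $\rho_s(c,i,j)$ be the permutation of $\Lambda$ mapping $a_{ri}\mapsto a_{rj}$ for all rows $r$ with $a_{rc}=s$. With $\pi(\gamma)\in\mathbb{Z}_2$ denoting the parity of a permutation $\gamma$ ($0$ for even, $1$ for odd), define $\tau^c_{ij}(A)=\sum_{s\in\Lambda}\pi(\rho_s(c,i,j))\in\mathbb{Z}_2$. The $\tau$-parity of $A$ is the vector $(\tau^c_{ij}(A))$ indexed by the $k(k-1)(k-2)$ ordered triples $(c,i,j)$ of distinct elements of $\{1,\dots,k\}$. $\mathcal{B}(k,n)$ denotes $\log_2$ of the number of different $\tau$-parities achieved by orthogonal arrays $\mathrm{OA}(k,n)$ (on a fixed alphabet of size $n$). *)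

theory Defs
  imports Complex_Main "HOL-Combinatorics.Permutations" "HOL-Library.FuncSet" "HOL-Library.Z2"
begin

text \<open>
  A matrix is a function of a row index in \<open>{1..(card \<Lambda>)\<^sup>2}\<close> and a column index in
  \<open>{1..k}\<close>; its values at other indices are irrelevant.
\<close>

definition orthogonal_array :: "nat \<Rightarrow> 'a set \<Rightarrow> (nat \<Rightarrow> nat \<Rightarrow> 'a) \<Rightarrow> bool" where
  "orthogonal_array k \<Lambda> A \<longleftrightarrow>
     finite \<Lambda> \<and>
     (\<forall>r\<in>{1..(card \<Lambda>)\<^sup>2}. \<forall>l\<in>{1..k}. A r l \<in> \<Lambda>) \<and>
     (\<forall>i\<in>{1..k}. \<forall>j\<in>{1..k}. i \<noteq> j \<longrightarrow>
        (\<forall>x\<in>\<Lambda>. \<forall>y\<in>\<Lambda>. \<exists>!r. r \<in> {1..(card \<Lambda>)\<^sup>2} \<and> A r i = x \<and> A r j = y))"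

text \<open>
  The permutation \<open>\<rho>\<^sub>s(c,i,j)\<close>, extended by the identity outside \<open>\<Lambda>\<close>: for \<open>x \<in> \<Lambda>\<close> there is
  exactly one row with \<open>s\<close> in column \<open>c\<close> and \<open>x\<close> in column \<open>i\<close> (see \<open>rho_apply\<close>).
\<close>

definition rho :: "'a set \<Rightarrow> (nat \<Rightarrow> nat \<Rightarrow> 'a) \<Rightarrow> nat \<Rightarrow> nat \<Rightarrow> nat \<Rightarrow> 'a \<Rightarrow> 'a \<Rightarrow> 'a" where
  "rho \<Lambda> A c i j s x =
     (if x \<in> \<Lambda> then A (THE r. r \<in> {1..(card \<Lambda>)\<^sup>2} \<and> A r c = s \<and> A r i = x) j else x)"

definition perm_parity :: "('a \<Rightarrow> 'a) \<Rightarrow> bit" where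
  "perm_parity p = (if evenperm p then 0 else 1)"

definition tau :: "'a set \<Rightarrow> (nat \<Rightarrow> nat \<Rightarrow> 'a) \<Rightarrow> nat \<Rightarrow> nat \<Rightarrow> nat \<Rightarrow> bit" where
  "tau \<Lambda> A c i j = (\<Sum>s\<in>\<Lambda>. perm_parity (rho \<Lambda> A c i j s))"

definition distinct_triples :: "nat \<Rightarrow> (nat \<times> nat \<times> nat) set" where
  "distinct_triples k =
     {(c, i, j). c \<in> {1..k} \<and> i \<in> {1..k} \<and> j \<in> {1..k} \<and> c \<noteq> i \<and> c \<noteq> j \<and> i \<noteq> j}"

definition tau_parity :: "nat \<Rightarrow> 'a set \<Rightarrow> (nat \<Rightarrow> nat \<Rightarrow> 'a) \<Rightarrow> nat \<times> nat \<times> nat \<Rightarrow> bit" where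
  "tau_parity k \<Lambda> A = restrict (\<lambda>(c, i, j). tau \<Lambda> A c i j) (distinct_triples k)"

definition tau_parities :: "nat \<Rightarrow> 'a set \<Rightarrow> (nat \<times> nat \<times> nat \<Rightarrow> bit) set" where
  "tau_parities k \<Lambda> = {tau_parity k \<Lambda> A | A. orthogonal_array k \<Lambda> A}"

text \<open>The choice of the alphabet \<open>{1..n}\<close> is immaterial, see \<open>tau_parities_alphabet\<close>.\<close>

definition calB :: "nat \<Rightarrow> nat \<Rightarrow> real" where
  "calB k n = log 2 (real (card (tau_parities k {1..n})))"


lemma orthogonal_array_row:
  assumes "orthogonal_array k \<Lambda> A" "c \<in> {1..k}" "i \<in> {1..k}" "c \<noteq> i" "s \<in> \<Lambda>" "x \<in> \<Lambda>"
  shows "\<exists>!r. r \<in> {1..(card \<Lambda>)\<^sup>2} \<and> A r c = s \<and> A r i = x"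
  using assms unfolding orthogonal_array_def by blast

lemma rho_apply:
  assumes "orthogonal_array k \<Lambda> A" "c \<in> {1..k}" "i \<in> {1..k}" "c \<noteq> i"
    and "r \<in> {1..(card \<Lambda>)\<^sup>2}" "A r c = s"
  shows "rho \<Lambda> A c i j s (A r i) = A r j"
proof -
  have L: "A r i \<in> \<Lambda>" "s \<in> \<Lambda>"
    using assms unfolding orthogonal_array_def by blast+
  have "(THE r'. r' \<in> {1..(card \<Lambda>)\<^sup>2} \<and> A r' c = s \<and> A r' i = A r i) = r"
    by (rule the1_equality[OF orthogonal_array_row[OF assms(1-4) L(2,1)]]) (use assms in blast)
  then show ?thesis using L by (simp add: rho_def)
qed

lemma rho_permutes:
  assumes A: "orthogonal_array k \<Lambda> A" "c \<in> {1..k}" "i \<in> {1..k}" "j \<in> {1..k}"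
    "c \<noteq> i" "c \<noteq> j" and s: "s \<in> \<Lambda>"
  shows "rho \<Lambda> A c i j s permutes \<Lambda>"
proof (rule bij_imp_permutes)
  have fin: "finite \<Lambda>" using A(1) unfolding orthogonal_array_def by blast
  have surj: "\<Lambda> \<subseteq> rho \<Lambda> A c i j s ` \<Lambda>"
  proof
    fix y assume "y \<in> \<Lambda>"
    then obtain r where r: "r \<in> {1..(card \<Lambda>)\<^sup>2}" "A r c = s" "A r j = y"
      using orthogonal_array_row[OF A(1,2,4,6) s] by blast
    have "A r i \<in> \<Lambda>" using A(1,3) r(1) unfolding orthogonal_array_def by blast
    then show "y \<in> rho \<Lambda> A c i j s ` \<Lambda>"
      using rho_apply[OF A(1,2,3,5) r(1,2), of j] r(3) by (metis image_eqI)
  qed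
  have "rho \<Lambda> A c i j s x \<in> \<Lambda>" if x: "x \<in> \<Lambda>" for x
  proof -
    obtain r where r: "r \<in> {1..(card \<Lambda>)\<^sup>2}" "A r c = s" "A r i = x"
      using orthogonal_array_row[OF A(1,2,3,5) s x] by blast
    have "A r j \<in> \<Lambda>" using A(1,4) r(1) unfolding orthogonal_array_def by blast
    then show ?thesis using rho_apply[OF A(1,2,3,5) r(1,2), of j] r(3) by simp
  qed
  with surj have im: "rho \<Lambda> A c i j s ` \<Lambda> = \<Lambda>" by blast
  then have "inj_on (rho \<Lambda> A c i j s) \<Lambda>"
    using fin by (metis finite_surj_inj order_refl)
  with im show "bij_betw (rho \<Lambda> A c i j s) \<Lambda> \<Lambda>" by (simp add: bij_betw_def)
qed (simp add: rho_def)

lemma tau_parities_alphabet_subset: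
  assumes f: "bij_betw f \<Lambda> \<Lambda>'"
  shows "tau_parities k \<Lambda> \<subseteq> tau_parities k \<Lambda>'"
proof
  fix v assume "v \<in> tau_parities k \<Lambda>"
  then obtain A where A: "orthogonal_array k \<Lambda> A" and v: "v = tau_parity k \<Lambda> A"
    unfolding tau_parities_def by blast
  define B where "B = (\<lambda>r l. f (A r l))"
  have inj: "inj_on f \<Lambda>" and im: "\<Lambda>' = f ` \<Lambda>" using f by (auto simp: bij_betw_def)
  have card: "card \<Lambda>' = card \<Lambda>" using inj im by (simp add: card_image)
  have fin: "finite \<Lambda>" using A unfolding orthogonal_array_def by blast
  have AL: "A r l \<in> \<Lambda>" if "r \<in> {1..(card \<Lambda>)\<^sup>2}" "l \<in> {1..k}" for r l
    using A that unfolding orthogonal_array_def by blast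
  have B: "orthogonal_array k \<Lambda>' B"
    unfolding orthogonal_array_def card
  proof (intro conjI ballI impI)
    show "finite \<Lambda>'" using fin im by simp
  next
    fix r l assume "r \<in> {1..(card \<Lambda>)\<^sup>2}" "l \<in> {1..k}"
    then show "B r l \<in> \<Lambda>'" using AL im by (simp add: B_def)
  next
    fix i j x' y'
    assume ij: "i \<in> {1..k}" "j \<in> {1..k}" "i \<noteq> j" and "x' \<in> \<Lambda>'" "y' \<in> \<Lambda>'"
    then obtain x y where xy: "x \<in> \<Lambda>" "y \<in> \<Lambda>" "x' = f x" "y' = f y" using im by blast
    have "(r \<in> {1..(card \<Lambda>)\<^sup>2} \<and> B r i = x' \<and> B r j = y') \<longleftrightarrow>
          (r \<in> {1..(card \<Lambda>)\<^sup>2} \<and> A r i = x \<and> A r j = y)" for r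
      using AL[of r i] AL[of r j] ij xy inj by (auto simp: B_def inj_on_eq_iff)
    then show "\<exists>!r. r \<in> {1..(card \<Lambda>)\<^sup>2} \<and> B r i = x' \<and> B r j = y'"
      using orthogonal_array_row[OF A ij xy(1,2)] by simp
  qed
  have "tau \<Lambda>' B c i j = tau \<Lambda> A c i j" if t: "(c, i, j) \<in> distinct_triples k" for c i j
  proof -
    have t': "c \<in> {1..k}" "i \<in> {1..k}" "j \<in> {1..k}" "c \<noteq> i" "c \<noteq> j"
      using t by (auto simp: distinct_triples_def)
    have "perm_parity (rho \<Lambda>' B c i j (f s)) = perm_parity (rho \<Lambda> A c i j s)"
      if s: "s \<in> \<Lambda>" for s
    proof -
      have "rho \<Lambda>' B c i j (f s) = map_permutation \<Lambda> f (rho \<Lambda> A c i j s)"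
      proof
        fix x'
        show "rho \<Lambda>' B c i j (f s) x' = map_permutation \<Lambda> f (rho \<Lambda> A c i j s) x'"
        proof (cases "x' \<in> \<Lambda>'")
          case True
          then obtain x where x: "x \<in> \<Lambda>" "x' = f x" using im by blast
          obtain r where r: "r \<in> {1..(card \<Lambda>)\<^sup>2}" "A r c = s" "A r i = x"
            using orthogonal_array_row[OF A t'(1,2,4) s x(1)] by blast
          have "rho \<Lambda>' B c i j (f s) (B r i) = B r j"
            by (rule rho_apply[OF B t'(1,2,4)]) (use r card in \<open>simp_all add: B_def\<close>)
          moreover have "rho \<Lambda> A c i j s x = A r j"
            using rho_apply[OF A t'(1,2,4) r(1,2), of j] r(3) by simp
          ultimately show ?thesis
            using x r inj by (simp add: B_def map_permutation_apply)
        next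
          case False
          then show ?thesis using im by (simp add: rho_def map_permutation_def)
        qed
      qed
      then show ?thesis
        using evenperm_map_permutation[OF inj rho_permutes[OF A t' s] fin]
        by (simp add: perm_parity_def)
    qed
    then have "(\<Sum>s\<in>\<Lambda>. perm_parity (rho \<Lambda>' B c i j (f s))) = tau \<Lambda> A c i j"
      unfolding tau_def by (rule sum.cong[OF refl])
    then show ?thesis
      unfolding tau_def
      using sum.reindex_bij_betw[OF f, of "\<lambda>s. perm_parity (rho \<Lambda>' B c i j s)"] by argo
  qed
  then have "v = tau_parity k \<Lambda>' B"
    unfolding v tau_parity_def by (auto intro!: restrict_ext)
  with B show "v \<in> tau_parities k \<Lambda>'" unfolding tau_parities_def by blast
qed

lemma tau_parities_alphabet:
  assumes "bij_betw f \<Lambda> \<Lambda>'"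
  shows "tau_parities k \<Lambda> = tau_parities k \<Lambda>'"
  using tau_parities_alphabet_subset[OF assms]
    tau_parities_alphabet_subset[OF bij_betw_inv_into[OF assms]] by blast

end

(*
The relations t(c;i,j) + t(c;j,l) = t(c;i,l) and t(c;i,j) + t(i;j,c) + t(j;c,i) = const(n) show that the
parity is determined by its binom(k,2) - 1 entries at the triples (1;2,j), (2;1,j), (i;1,j) with
3 <= i < j, so it remains to realise all values of these entries, and dropping columns reduces this to
k = 5. Replacing a subarray of an array changes the parity by the difference of the parities of the two
subarrays. Hence the property that all values are realised passes from a hole to every alphabet carrying
an incomplete array with that hole. In order 11 the linear arrays realise everything, because the parity
of x -> m x + t is the quadratic character of m and the Paley tournament of order 11 contains all labelled
tournaments on four vertices. A linear array of order 11 w has a subarray of order 11, and Wilson's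
construction with blocks of orders 4 and 5 (n odd) or 7 and 8 (n even) gives an incomplete array of every
large order n with a hole of some order 11 w.
*)

theory Submission
  imports Defs
begin

text \<open>Over Z_n with n divisible by 2 or 3 there are no five pairwise independent linear
  columns, since only 3 or 4 directions exist modulo 2 or 3; and the parity of an array assembled by
  Wilson's construction is unwieldy to compute. Both difficulties disappear when surjectivity onto
  the free entries is carried along instead of individual parities: the rows outside a hole
  contribute a fixed unknown shift, which leaves surjectivity intact. So parities are evaluated in
  order 11 only. The order 11 is the least one at which a Paley tournament can serve: in order 7 the
  out-neighbourhood of every vertex is a 3-cycle, so the transitive tournament on four vertices is
  missing.\<close>

text \<open>By default the simplifier rewrites addition of bits into \<open>XOR\<close>.\<close>

declare add_bit_eq_xor [simp del]

lemma bit_add_self [simp]: "a + a = (0 :: bit)" "a + (a + b) = (b :: bit)"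
  by (cases a; cases b; simp)+

subsection \<open>Parities of permutations\<close>

lemma perm_parity_id [simp]: "perm_parity (\<lambda>x. x) = 0" "perm_parity id = 0"
  by (simp_all add: perm_parity_def)

lemma perm_parity_comp:
  assumes "permutation p" "permutation q"
  shows "perm_parity (p \<circ> q) = perm_parity p + perm_parity q"
  using evenperm_comp[OF assms] by (auto simp: perm_parity_def)

lemma permutes_imp_permutation: "finite S \<Longrightarrow> p permutes S \<Longrightarrow> permutation p"
  by (auto simp: permutation_permutes)

text \<open>Gluing the \<open>P s\<close> into one permutation of pairs turns an entry of the parity
  vector into the parity of a single permutation, so that entries with different first index can be
  combined by composition.\<close>

definition fibre_perm :: "'s set \<Rightarrow> ('s \<Rightarrow> 'a \<Rightarrow> 'a) \<Rightarrow> 's \<times> 'a \<Rightarrow> 's \<times> 'a" where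
  "fibre_perm S P = (\<lambda>(s, x). if s \<in> S then (s, P s x) else (s, x))"

lemma fibre_perm_parity:
  assumes "finite S" "finite L" "\<And>s. s \<in> S \<Longrightarrow> P s permutes L"
  shows "permutation (fibre_perm S P) \<and> perm_parity (fibre_perm S P) = (\<Sum>s\<in>S. perm_parity (P s))"
  using assms(1,3)
proof (induction S)
  case empty
  have "fibre_perm {} P = id" by (auto simp: fibre_perm_def)
  then show ?case by simp
next
  case (insert s S)
  \<comment> \<open>One fibre at a time: \<open>Q\<close> is \<open>P s\<close> transported to the
    fibre over \<open>s\<close>, which preserves its parity.\<close>
  define Q where "Q = map_permutation L (Pair s) (P s)"
  have P: "P s permutes L" using insert.prems by blast
  have Qp: "permutation Q"
    using map_permutation_permutes[of "Pair s" L "Pair s ` L" "P s"] P \<open>finite L\<close>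
    unfolding Q_def by (intro permutes_imp_permutation[of "Pair s ` L"]) (auto simp: bij_betw_def inj_on_def)
  have Qpar: "perm_parity Q = perm_parity (P s)"
    using evenperm_map_permutation[of "Pair s" L "P s"] P \<open>finite L\<close>
    unfolding Q_def perm_parity_def by (auto simp: inj_on_def)
  have Qs: "Q (s, x) = (s, P s x)" for x
  proof (cases "x \<in> L")
    case True
    then show ?thesis unfolding Q_def by (subst map_permutation_apply) (auto simp: inj_on_def)
  next
    case False
    then show ?thesis using P unfolding Q_def
      by (auto simp: map_permutation_def restrict_id_def permutes_not_in)
  qed
  have Qn: "Q (t, x) = (t, x)" if "t \<noteq> s" for t x
    using that unfolding Q_def by (auto simp: map_permutation_def restrict_id_def)
  have "fibre_perm (insert s S) P = Q \<circ> fibre_perm S P"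
  proof
    fix p
    show "fibre_perm (insert s S) P p = (Q \<circ> fibre_perm S P) p"
      using insert.hyps Qn[of "fst p"] by (cases p; cases "fst p = s") (auto simp: fibre_perm_def Qs)
  qed
  moreover have "permutation (fibre_perm S P) \<and> perm_parity (fibre_perm S P) = (\<Sum>s\<in>S. perm_parity (P s))"
    using insert by blast
  ultimately show ?case
    using insert.hyps Qp Qpar by (simp add: perm_parity_comp permutation_compose del: o_apply)
qed

text \<open>On a finite alphabet of size n it is a product of binom(n,2) transpositions; its parity
  is the constant const(n) of the cyclic relation.\<close>

definition swap_perm :: "'a set \<Rightarrow> 'a \<times> 'a \<Rightarrow> 'a \<times> 'a" where
  "swap_perm L = (\<lambda>(x, y). if x \<in> L \<and> y \<in> L then (y, x) else (x, y))"

lemma permutation_swap_perm: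
  assumes "finite L"
  shows "permutation (swap_perm L)"
proof (rule permutes_imp_permutation)
  show "swap_perm L permutes L \<times> L"
    by (rule bij_imp_permutes, rule bij_betw_byWitness[where f' = "swap_perm L"])
      (auto simp: swap_perm_def split: if_splits)
qed (use assms in simp)

subsection \<open>Linear relations between the entries of a \<tau>-parity\<close>

lemma orthogonal_array_finite: "orthogonal_array k L A \<Longrightarrow> finite L"
  by (simp add: orthogonal_array_def)

lemma orthogonal_array_in:
  "orthogonal_array k L A \<Longrightarrow> r \<in> {1..(card L)\<^sup>2} \<Longrightarrow> l \<in> {1..k} \<Longrightarrow> A r l \<in> L"
  by (auto simp: orthogonal_array_def)

lemma rho_comp:
  assumes A: "orthogonal_array k L A" and "c \<in> {1..k}" "i \<in> {1..k}" "j \<in> {1..k}" "c \<noteq> i" "c \<noteq> j"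
    and s: "s \<in> L"
  shows "rho L A c j l s \<circ> rho L A c i j s = rho L A c i l s"
proof
  fix x
  show "(rho L A c j l s \<circ> rho L A c i j s) x = rho L A c i l s x"
  proof (cases "x \<in> L")
    case True
    then obtain r where r: "r \<in> {1..(card L)\<^sup>2}" "A r c = s" "A r i = x"
      using orthogonal_array_row[OF A assms(2,3,5) s] by blast
    then show ?thesis
      using rho_apply[OF A assms(2,3,5) r(1,2)] rho_apply[OF A assms(2,4,6) r(1,2)] by simp
  qed (simp add: rho_def)
qed

lemma rho_permutation:
  assumes "orthogonal_array k L A" "c \<in> {1..k}" "i \<in> {1..k}" "j \<in> {1..k}" "c \<noteq> i" "c \<noteq> j" "s \<in> L"
  shows "permutation (rho L A c i j s)"
  using rho_permutes[OF assms] orthogonal_array_finite[OF assms(1)] permutes_imp_permutation by blast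

text \<open>Columns \<open>i\<close>, \<open>j\<close>, \<open>l\<close> may coincide:
  \<open>i = j = l\<close> gives \<open>tau_same\<close>, and \<open>l = i\<close> then gives
  \<open>tau_sym\<close>.\<close>

lemma tau_add:
  assumes A: "orthogonal_array k L A" "c \<in> {1..k}" "i \<in> {1..k}" "j \<in> {1..k}" "l \<in> {1..k}"
    "c \<noteq> i" "c \<noteq> j" "c \<noteq> l"
  shows "tau L A c i l = tau L A c i j + tau L A c j l"
proof -
  have "perm_parity (rho L A c i l s) = perm_parity (rho L A c i j s) + perm_parity (rho L A c j l s)"
    if s: "s \<in> L" for s
    using perm_parity_comp[OF rho_permutation[OF A(1,2,4,5,7,8) s] rho_permutation[OF A(1-4,6,7) s]]
    unfolding rho_comp[OF A(1-4,6,7) s] by (simp only: add.commute)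
  then show ?thesis by (simp add: tau_def sum.distrib)
qed

lemma tau_same:
  assumes "orthogonal_array k L A" "c \<in> {1..k}" "i \<in> {1..k}" "c \<noteq> i"
  shows "tau L A c i i = 0"
  using tau_add[OF assms(1-3,3,3,4,4,4)] by (cases "tau L A c i i") auto

lemma tau_sym:
  assumes "orthogonal_array k L A" "c \<in> {1..k}" "i \<in> {1..k}" "j \<in> {1..k}" "c \<noteq> i" "c \<noteq> j"
  shows "tau L A c j i = tau L A c i j"
  using tau_add[OF assms(1-4,3,5,6,5)] tau_same[OF assms(1-3,5)]
  by (cases "tau L A c i j"; cases "tau L A c j i") auto

text \<open>
  Sending \<open>(a\<^sub>c, a\<^sub>i)\<close> to \<open>(a\<^sub>c, a\<^sub>j)\<close>, then to \<open>(a\<^sub>i, a\<^sub>j)\<close>, then to \<open>(a\<^sub>i, a\<^sub>c)\<close> swaps the entries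
  of a pair, and each of the three steps is fibrewise a permutation counted by one entry of \<open>\<tau>\<close>.
\<close>

lemma tau_cyclic:
  assumes A: "orthogonal_array k L A" "c \<in> {1..k}" "i \<in> {1..k}" "j \<in> {1..k}"
    and ne: "c \<noteq> i" "c \<noteq> j" "i \<noteq> j"
  shows "tau L A c i j + tau L A i j c + tau L A j c i = perm_parity (swap_perm L)"
proof -
  note fin = orthogonal_array_finite[OF A(1)]
  define F where "F = (\<lambda>c i j. fibre_perm L (rho L A c i j))"
  have par: "permutation (F c i j) \<and> perm_parity (F c i j) = tau L A c i j"
    if "c \<in> {1..k}" "i \<in> {1..k}" "j \<in> {1..k}" "c \<noteq> i" "c \<noteq> j" for c i j
    unfolding F_def tau_def
    by (rule fibre_perm_parity[OF fin fin]) (use rho_permutes[OF A(1) that] in blast)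
  have F: "F c i j (A r c, A r i) = (A r c, A r j)"
    if "c \<in> {1..k}" "i \<in> {1..k}" "c \<noteq> i" "r \<in> {1..(card L)\<^sup>2}" for c i j r
    unfolding F_def fibre_perm_def
    using rho_apply[OF A(1) that(1-4) refl] orthogonal_array_in[OF A(1) that(4)] that by simp
  have Fout: "F c i j (x, y) = (x, y)" if "\<not> (x \<in> L \<and> y \<in> L)" for c i j x y
    using that unfolding F_def fibre_perm_def by (auto simp: rho_def)
  let ?\<sigma> = "swap_perm L"
  have \<sigma>: "permutation ?\<sigma>" using permutation_swap_perm[OF fin] .
  \<comment> \<open>Each \<open>F\<close> preserves the first coordinate, so the two inner swaps
    bring the column to be kept to the front: (c,i), (c,j), (j,c), (j,i), (i,j), (i,c). Their
    parities cancel.\<close>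
  have "F i j c \<circ> (?\<sigma> \<circ> (F j c i \<circ> (?\<sigma> \<circ> F c i j))) = ?\<sigma>"
  proof
    fix p
    show "(F i j c \<circ> (?\<sigma> \<circ> (F j c i \<circ> (?\<sigma> \<circ> F c i j)))) p = ?\<sigma> p"
    proof (cases "fst p \<in> L \<and> snd p \<in> L")
      case True
      then obtain r where r: "r \<in> {1..(card L)\<^sup>2}" "p = (A r c, A r i)"
        using orthogonal_array_row[OF A(1-3) ne(1), of "fst p" "snd p"] by (metis prod.collapse)
      note L = orthogonal_array_in[OF A(1) r(1)]
      have "F c i j p = (A r c, A r j)" "F j c i (A r j, A r c) = (A r j, A r i)"
        "F i j c (A r i, A r j) = (A r i, A r c)"
        unfolding r(2) using F r A ne by metis+
      then show ?thesis using L A r(2) by (simp add: swap_perm_def)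
    next
      case False
      then have "?\<sigma> p = p" "F i j c p = p" "F j c i p = p" "F c i j p = p"
        by (cases p; auto simp: Fout swap_perm_def)+
      then show ?thesis by simp
    qed
  qed
  moreover have "perm_parity (F i j c \<circ> (?\<sigma> \<circ> (F j c i \<circ> (?\<sigma> \<circ> F c i j)))) =
      tau L A i j c + (perm_parity ?\<sigma> + (tau L A j c i + (perm_parity ?\<sigma> + tau L A c i j)))"
    using par[of c i j] par[of i j c] par[of j c i] A ne \<sigma>
    by (simp add: perm_parity_comp permutation_compose)
  ultimately show ?thesis
    by (cases "perm_parity ?\<sigma>"; cases "tau L A c i j"; cases "tau L A i j c"; cases "tau L A j c i") auto
qed

subsection \<open>The upper bound\<close>

definition basic_triples :: "nat \<Rightarrow> (nat \<times> nat \<times> nat) set" where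
  "basic_triples k = (\<lambda>j. (1, 2, j)) ` {3..k} \<union> (\<lambda>j. (2, 1, j)) ` {3..k} \<union>
     (\<lambda>(i, j). (i, 1, j)) ` (SIGMA i:{3..k}. {i<..k})"

lemma basic_triples_subset: "k \<ge> 2 \<Longrightarrow> basic_triples k \<subseteq> distinct_triples k"
  by (auto simp: basic_triples_def distinct_triples_def)

lemma basic_triples_mono: "k \<le> k' \<Longrightarrow> basic_triples k \<subseteq> basic_triples k'"
  by (fastforce simp: basic_triples_def)

lemma finite_basic_triples: "finite (basic_triples k)"
  by (auto simp: basic_triples_def)

text \<open>By additivity and symmetry the entries at a fixed \<open>c\<close> follow from those at
  \<open>(c, m, l)\<close> for one base column \<open>m\<close>: 2 for \<open>c = 1\<close>, and 1
  otherwise. For \<open>c \<ge> 3\<close> the base entries with \<open>l = 2\<close> or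
  \<open>3 \<le> l < c\<close> are not basic; the cyclic relation on \<open>c\<close>, 1,
  \<open>l\<close> gives them, its two other entries being known already.\<close>

lemma tau_parity_determined:
  assumes A: "orthogonal_array k L A" and B: "orthogonal_array k L B"
    and eq: "\<And>c i j. (c, i, j) \<in> basic_triples k \<Longrightarrow> tau L A c i j = tau L B c i j"
    and k: "k \<ge> 2"
  shows "tau_parity k L A = tau_parity k L B"
proof -
  let ?a = "tau L A" and ?b = "tau L B"
  have cyc: "?a c i j + ?a i j c + ?a j c i = ?b c i j + ?b i j c + ?b j c i"
    if "c \<in> {1..k}" "i \<in> {1..k}" "j \<in> {1..k}" "c \<noteq> i" "c \<noteq> j" "i \<noteq> j" for c i j
    using tau_cyclic[OF A that] tau_cyclic[OF B that] by simp
  have sym: "?a c j i = ?a c i j" "?b c j i = ?b c i j"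
    if "c \<in> {1..k}" "i \<in> {1..k}" "j \<in> {1..k}" "c \<noteq> i" "c \<noteq> j" for c i j
    using tau_sym[OF A that] tau_sym[OF B that] by auto
  have add: "?a c i l = ?a c i j + ?a c j l" "?b c i l = ?b c i j + ?b c j l"
    if "c \<in> {1..k}" "i \<in> {1..k}" "j \<in> {1..k}" "l \<in> {1..k}" "c \<noteq> i" "c \<noteq> j" "c \<noteq> l" for c i j l
    using tau_add[OF A that] tau_add[OF B that] by auto
  have e1: "?a 1 2 j = ?b 1 2 j" if "j \<in> {3..k}" for j
    using that by (intro eq) (auto simp: basic_triples_def)
  have e2: "?a 2 1 j = ?b 2 1 j" if "j \<in> {3..k}" for j
    using that by (intro eq) (auto simp: basic_triples_def)
  have e3: "?a i 1 j = ?b i 1 j" if "i \<in> {3..k}" "j \<in> {i<..k}" for i j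
    using that by (intro eq) (auto simp: basic_triples_def)
  have from_base: "?a c i j = ?b c i j"
    if "c \<in> {1..k}" "i \<in> {1..k}" "j \<in> {1..k}" "m \<in> {1..k}" "c \<noteq> i" "c \<noteq> j" "c \<noteq> m"
      and base: "\<And>l. l \<in> {1..k} \<Longrightarrow> l \<noteq> c \<Longrightarrow> l \<noteq> m \<Longrightarrow> ?a c m l = ?b c m l" for c m i j
  proof -
    have m: "?a c m l = ?b c m l" if "l \<in> {1..k}" "l \<noteq> c" for l
      using base[OF that] tau_same[OF A, of c m] tau_same[OF B, of c m] \<open>c \<in> {1..k}\<close> \<open>m \<in> {1..k}\<close> \<open>c \<noteq> m\<close>
      by (cases "l = m") auto
    show ?thesis
      using add[of c i m j] sym[of c m i] m[of i] m[of j] that by auto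
  qed
  have c1: "?a 1 i j = ?b 1 i j" if "i \<in> {1..k}" "j \<in> {1..k}" "1 \<noteq> i" "1 \<noteq> j" for i j
    by (rule from_base[where m = 2]) (use that k e1 in auto)
  have c2: "?a 2 i j = ?b 2 i j" if "i \<in> {1..k}" "j \<in> {1..k}" "2 \<noteq> i" "2 \<noteq> j" for i j
    by (rule from_base[where m = 1]) (use that k e2 in auto)
  have c3: "?a c 1 l = ?b c 1 l" if "c \<in> {3..k}" "l \<in> {1..k}" "l \<noteq> c" "l \<noteq> 1" for c l
  proof -
    have "l = 2 \<or> 3 \<le> l \<and> l < c \<or> c < l" using that by simp linarith
    moreover have "l \<le> k" using that by simp
    ultimately consider "l = 2" | "l \<in> {3..k}" "l < c" | "l \<in> {c<..k}" by fastforce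
    then show ?thesis
    proof cases
      case 1
      have "?a c 1 2 + ?a 1 2 c + ?a 2 c 1 = ?b c 1 2 + ?b 1 2 c + ?b 2 c 1"
        "?a 1 2 c = ?b 1 2 c" "?a 2 c 1 = ?b 2 c 1"
        using that k by (intro cyc c1 c2; simp)+
      then show ?thesis using 1 by simp
    next
      case 2
      have "?a c 1 l + ?a 1 l c + ?a l c 1 = ?b c 1 l + ?b 1 l c + ?b l c 1"
        "?a 1 l c = ?b 1 l c" "?a l c 1 = ?a l 1 c" "?b l c 1 = ?b l 1 c" "?a l 1 c = ?b l 1 c"
        using that 2 k by (intro cyc c1 sym e3; simp)+
      then show ?thesis by simp
    next
      case 3
      then show ?thesis using e3 that by simp
    qed
  qed
  have "?a c i j = ?b c i j" if "(c, i, j) \<in> distinct_triples k" for c i j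
  proof -
    have t: "c \<in> {1..k}" "i \<in> {1..k}" "j \<in> {1..k}" "c \<noteq> i" "c \<noteq> j"
      using that by (auto simp: distinct_triples_def)
    consider "c = 1" | "c = 2" | "c \<in> {3..k}" using t by force
    then show ?thesis
    proof cases
      case 3
      show ?thesis by (rule from_base[where m = 1]) (use t k 3 c3[OF 3] in auto)
    qed (use c1 c2 t in simp_all)
  qed
  then show ?thesis unfolding tau_parity_def by (auto intro!: restrict_ext)
qed

section \<open>Prescribing the free entries\<close>

definition realises_all :: "nat \<Rightarrow> 'a set \<Rightarrow> bool" where
  "realises_all k L \<longleftrightarrow>
     (\<forall>v. \<exists>A. orthogonal_array k L A \<and> (\<forall>(c, i, j)\<in>basic_triples k. tau L A c i j = v (c, i, j)))"

text \<open>Restriction to the basic triples is a bijection onto all bit-valued functions there: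
  injective by \<open>tau_parity_determined\<close>, surjective by
  \<open>realises_all\<close>.\<close>

lemma card_tau_parities:
  assumes k: "k \<ge> 2" and all: "realises_all k L"
  shows "card (tau_parities k L) = 2 ^ card (basic_triples k)"
proof -
  let ?D = "basic_triples k"
  note sub = basic_triples_subset[OF k]
  have val: "tau_parity k L A (c, i, j) = tau L A c i j" if "(c, i, j) \<in> ?D" for A c i j
    using that sub by (auto simp: tau_parity_def)
  have "bij_betw (\<lambda>w. restrict w ?D) (tau_parities k L) (?D \<rightarrow>\<^sub>E UNIV)"
  proof (rule bij_betwI')
    fix v w assume v: "v \<in> tau_parities k L" and w: "w \<in> tau_parities k L"
    then obtain A B where AB: "orthogonal_array k L A" "v = tau_parity k L A"
      "orthogonal_array k L B" "w = tau_parity k L B"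
      unfolding tau_parities_def by blast
    show "restrict v ?D = restrict w ?D \<longleftrightarrow> v = w"
    proof
      assume eq: "restrict v ?D = restrict w ?D"
      have "tau L A c i j = tau L B c i j" if "(c, i, j) \<in> ?D" for c i j
        using fun_cong[OF eq, of "(c, i, j)"] that by (simp add: AB val)
      then show "v = w" using tau_parity_determined[OF AB(1,3) _ k] AB by blast
    qed simp
  next
    fix f :: "nat \<times> nat \<times> nat \<Rightarrow> bit" assume f: "f \<in> ?D \<rightarrow>\<^sub>E UNIV"
    obtain A where A: "orthogonal_array k L A" "\<forall>(c, i, j)\<in>?D. tau L A c i j = f (c, i, j)"
      using all unfolding realises_all_def by blast
    have "f = restrict (tau_parity k L A) ?D"
    proof
      fix t show "f t = restrict (tau_parity k L A) ?D t"
        using A(2) PiE_arb[OF f, of t] by (cases t) (auto simp: val)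
    qed
    then show "\<exists>w\<in>tau_parities k L. f = restrict w ?D"
      using A(1) unfolding tau_parities_def by blast
  qed auto
  then have "card (tau_parities k L) = card (?D \<rightarrow>\<^sub>E (UNIV :: bit set))"
    by (rule bij_betw_same_card)
  moreover have "(UNIV :: bit set) = {0, 1}" by (metis (mono_tags) UNIV_eq_I insert_iff bit_not_zero_iff)
  then have "card (UNIV :: bit set) = card {0, 1 :: bit}" by (rule arg_cong)
  ultimately show ?thesis
    by (simp add: card_funcsetE[OF finite_basic_triples] numeral_2_eq_2)
qed

lemma realises_all_alphabet:
  assumes k: "k \<ge> 2" and f: "bij_betw f L L'" and L: "realises_all k L"
  shows "realises_all k L'"
  unfolding realises_all_def
proof
  fix v
  note sub = basic_triples_subset[OF k]
  obtain A where A: "orthogonal_array k L A" "\<forall>(c, i, j)\<in>basic_triples k. tau L A c i j = v (c, i, j)"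
    using L unfolding realises_all_def by blast
  then have "tau_parity k L A \<in> tau_parities k L'"
    using tau_parities_alphabet[OF f, of k] unfolding tau_parities_def by blast
  then obtain B where B: "orthogonal_array k L' B" "tau_parity k L A = tau_parity k L' B"
    unfolding tau_parities_def by blast
  have "tau L' B c i j = v (c, i, j)" if "(c, i, j) \<in> basic_triples k" for c i j
    using fun_cong[OF B(2), of "(c, i, j)"] that subsetD[OF sub that] A(2) by (auto simp: tau_parity_def)
  with B(1) show "\<exists>A. orthogonal_array k L' A \<and> (\<forall>(c, i, j)\<in>basic_triples k. tau L' A c i j = v (c, i, j))"
    by blast
qed

lemma realises_all_fewer_columns:
  assumes "realises_all k' L" "k \<le> k'"
  shows "realises_all k L"
  unfolding realises_all_def
proof
  fix v
  obtain A where A: "orthogonal_array k' L A" "\<forall>(c, i, j)\<in>basic_triples k'. tau L A c i j = v (c, i, j)"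
    using assms(1) unfolding realises_all_def by blast
  have "orthogonal_array k L A"
    using A(1) \<open>k \<le> k'\<close> unfolding orthogonal_array_def by auto
  then show "\<exists>A. orthogonal_array k L A \<and> (\<forall>(c, i, j)\<in>basic_triples k. tau L A c i j = v (c, i, j))"
    using A(2) basic_triples_mono[OF \<open>k \<le> k'\<close>] by blast
qed

lemma card_basic_triples:
  assumes "k \<in> {3, 4, 5}"
  shows "real (card (basic_triples k)) = real (k choose 2) - 1"
proof -
  have "{3..3} = {3::nat}" "{3..4} = {3, 4::nat}" "{3..5} = {3, 4, 5::nat}"
    "{3<..3} = ({}::nat set)" "{3<..4} = {4::nat}" "{3<..5} = {4, 5::nat}"
    "{4<..4} = ({}::nat set)" "{4<..5} = {5::nat}" "{5<..5} = ({}::nat set)" by auto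
  then show ?thesis
    using assms by (auto simp: basic_triples_def Sigma_def card_insert_if choose_two)
qed

subsection \<open>Incomplete orthogonal arrays\<close>

text \<open>
  Rows are indexed by an arbitrary set \<open>I\<close>; the pairs with both entries in the hole \<open>H\<close> are not covered.
  An orthogonal array is the case \<open>H = {}\<close>.
\<close>

definition incomplete_array ::
    "nat \<Rightarrow> 'a set \<Rightarrow> 'a set \<Rightarrow> 'r set \<Rightarrow> ('r \<Rightarrow> nat \<Rightarrow> 'a) \<Rightarrow> bool" where
  "incomplete_array k L H I A \<longleftrightarrow>
     finite L \<and> H \<subseteq> L \<and>
     (\<forall>i\<in>{1..k}. \<forall>j\<in>{1..k}. i \<noteq> j \<longrightarrow> bij_betw (\<lambda>r. (A r i, A r j)) I (L \<times> L - H \<times> H))"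

lemma incomplete_array_bij:
  "incomplete_array k L H I A \<Longrightarrow> i \<in> {1..k} \<Longrightarrow> j \<in> {1..k} \<Longrightarrow> i \<noteq> j \<Longrightarrow>
    bij_betw (\<lambda>r. (A r i, A r j)) I (L \<times> L - H \<times> H)"
  unfolding incomplete_array_def by blast

lemma incomplete_array_pair:
  assumes "incomplete_array k L H I A" "r \<in> I" "i \<in> {1..k}" "j \<in> {1..k}" "i \<noteq> j"
  shows "A r i \<in> L \<and> A r j \<in> L \<and> \<not> (A r i \<in> H \<and> A r j \<in> H)"
  using bij_betw_apply[OF incomplete_array_bij[OF assms(1,3-5)] assms(2)] by simp

lemma incomplete_array_row:
  assumes "incomplete_array k L H I A" "i \<in> {1..k}" "j \<in> {1..k}" "i \<noteq> j"
    "x \<in> L" "y \<in> L" "\<not> (x \<in> H \<and> y \<in> H)"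
  shows "\<exists>r\<in>I. A r i = x \<and> A r j = y"
proof -
  have "(x, y) \<in> (\<lambda>r. (A r i, A r j)) ` I"
    unfolding bij_betw_imp_surj_on[OF incomplete_array_bij[OF assms(1-4)]] using assms(5-7) by simp
  then show ?thesis by auto
qed

lemma incomplete_array_row_unique:
  assumes "incomplete_array k L H I A" "i \<in> {1..k}" "j \<in> {1..k}" "i \<noteq> j"
    "r \<in> I" "r' \<in> I" "A r i = A r' i" "A r j = A r' j"
  shows "r = r'"
  using bij_betw_imp_inj_on[OF incomplete_array_bij[OF assms(1-4)]] assms(5-8)
  by (auto simp: inj_on_def)

lemma incomplete_arrayI:
  assumes "finite L" "H \<subseteq> L"
    and "\<And>i j r. i \<in> {1..k} \<Longrightarrow> j \<in> {1..k} \<Longrightarrow> i \<noteq> j \<Longrightarrow> r \<in> I \<Longrightarrow>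
      A r i \<in> L \<and> A r j \<in> L \<and> \<not> (A r i \<in> H \<and> A r j \<in> H)"
    and "\<And>i j r r'. i \<in> {1..k} \<Longrightarrow> j \<in> {1..k} \<Longrightarrow> i \<noteq> j \<Longrightarrow> r \<in> I \<Longrightarrow> r' \<in> I \<Longrightarrow>
      A r i = A r' i \<Longrightarrow> A r j = A r' j \<Longrightarrow> r = r'"
    and "\<And>i j x y. i \<in> {1..k} \<Longrightarrow> j \<in> {1..k} \<Longrightarrow> i \<noteq> j \<Longrightarrow> x \<in> L \<Longrightarrow> y \<in> L \<Longrightarrow>
      \<not> (x \<in> H \<and> y \<in> H) \<Longrightarrow> \<exists>r\<in>I. A r i = x \<and> A r j = y"
  shows "incomplete_array k L H I A"
  unfolding incomplete_array_def
proof (intro conjI ballI impI)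
  fix i j assume ij: "i \<in> {1..k}" "j \<in> {1..k}" "i \<noteq> j"
  show "bij_betw (\<lambda>r. (A r i, A r j)) I (L \<times> L - H \<times> H)"
  proof (rule bij_betwI')
    fix r r' assume "r \<in> I" "r' \<in> I"
    then show "((A r i, A r j) = (A r' i, A r' j)) = (r = r')" using assms(4)[OF ij] by auto
  next
    fix r assume "r \<in> I"
    then show "(A r i, A r j) \<in> L \<times> L - H \<times> H" using assms(3)[OF ij] by auto
  next
    fix p assume "p \<in> L \<times> L - H \<times> H"
    then show "\<exists>r\<in>I. p = (A r i, A r j)"
      using assms(5)[OF ij, of "fst p" "snd p"] by (cases p) fastforce
  qed
qed (use assms in auto)

text \<open>Deleting a subarray digs a hole. It is enough that \<open>J\<close> covers exactly
  \<open>H \<times> H\<close>, because uniqueness is inherited from \<open>I\<close>.\<close>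

lemma incomplete_array_remove:
  assumes A: "incomplete_array k L {} I A" and H: "H \<subseteq> L" and J: "J \<subseteq> I"
    and sub: "\<And>i j. i \<in> {1..k} \<Longrightarrow> j \<in> {1..k} \<Longrightarrow> i \<noteq> j \<Longrightarrow>
      (\<lambda>r. (A r i, A r j)) ` J = H \<times> H"
  shows "incomplete_array k L H (I - J) A"
  unfolding incomplete_array_def
proof (intro conjI ballI impI)
  fix i j assume ij: "i \<in> {1..k}" "j \<in> {1..k}" "i \<noteq> j"
  let ?f = "\<lambda>r. (A r i, A r j)"
  have f: "bij_betw ?f I (L \<times> L)" using incomplete_array_bij[OF A ij] by simp
  then have "bij_betw ?f J (H \<times> H)"
    using bij_betw_subset[OF f J sub[OF ij]] by simp
  then show "bij_betw ?f (I - J) (L \<times> L - H \<times> H)"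
    by (rule bij_betw_DiffI[OF f _ J]) (use H in auto)
qed (use A H in \<open>auto simp: incomplete_array_def\<close>)

text \<open>For \<open>s\<close> in the hole, the rows with \<open>s\<close> in column
  \<open>c\<close> carry only elements of \<open>L - H\<close> in the other columns, so the
  permutation is given on \<open>L - H\<close> alone. The default \<open>x\<close> makes it fix the
  hole pointwise, so that filling the hole acts by composition.\<close>

definition hole_perm :: "'r set \<Rightarrow> ('r \<Rightarrow> nat \<Rightarrow> 'a) \<Rightarrow> nat \<Rightarrow> nat \<Rightarrow> nat \<Rightarrow> 'a \<Rightarrow> 'a \<Rightarrow> 'a" where
  "hole_perm I A c i j s x =
     (if \<exists>r\<in>I. A r c = s \<and> A r i = x then A (THE r. r \<in> I \<and> A r c = s \<and> A r i = x) j else x)"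

lemma hole_perm_apply:
  assumes A: "incomplete_array k L H I A" "c \<in> {1..k}" "i \<in> {1..k}" "c \<noteq> i"
    and r: "r \<in> I" "A r c = s" "A r i = x"
  shows "hole_perm I A c i j s x = A r j"
proof -
  have "(THE r. r \<in> I \<and> A r c = s \<and> A r i = x) = r"
    using incomplete_array_row_unique[OF A] r by (intro the_equality) auto
  then show ?thesis using r by (auto simp: hole_perm_def)
qed

section \<open>Filling a hole by an orthogonal array\<close>

definition fill :: "('r \<Rightarrow> nat \<Rightarrow> 'a) \<Rightarrow> ('s \<Rightarrow> nat \<Rightarrow> 'a) \<Rightarrow> 'r + 's \<Rightarrow> nat \<Rightarrow> 'a" where
  "fill A B = (\<lambda>r l. case r of Inl a \<Rightarrow> A a l | Inr b \<Rightarrow> B b l)"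

lemma fill_simps [simp]: "fill A B (Inl a) l = A a l" "fill A B (Inr b) l = B b l"
  by (simp_all add: fill_def)

lemma incomplete_array_fill:
  assumes A: "incomplete_array k L H I A" and B: "orthogonal_array k H B"
  shows "incomplete_array k L {} (I <+> {1..(card H)\<^sup>2}) (fill A B)"
proof -
  let ?J = "{1..(card H)\<^sup>2}"
  have fin: "finite L" and HL: "H \<subseteq> L" using A by (auto simp: incomplete_array_def)
  note BH = orthogonal_array_in[OF B]
  note pair = incomplete_array_pair[OF A]
  show ?thesis
  proof (rule incomplete_arrayI)
    fix i j r assume ij: "i \<in> {1..k}" "j \<in> {1..k}" "i \<noteq> j" and "r \<in> I <+> ?J"
    then show "fill A B r i \<in> L \<and> fill A B r j \<in> L \<and> \<not> (fill A B r i \<in> {} \<and> fill A B r j \<in> {})"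
      using pair[OF _ ij] BH[of _ i] BH[of _ j] HL by (auto elim!: PlusE)
  next
    fix i j r r' assume ij: "i \<in> {1..k}" "j \<in> {1..k}" "i \<noteq> j"
      and r: "r \<in> I <+> ?J" "r' \<in> I <+> ?J"
      and eq: "fill A B r i = fill A B r' i" "fill A B r j = fill A B r' j"
    have BB: "b = b'" if "b \<in> ?J" "b' \<in> ?J" "B b i = B b' i" "B b j = B b' j" for b b'
      using orthogonal_array_row[OF B ij BH[OF that(1) ij(1)] BH[OF that(1) ij(2)]] that by metis
    have AB: False if "a \<in> I" "b \<in> ?J" "A a i = B b i" "A a j = B b j" for a b
      using pair[OF that(1) ij] BH[OF that(2) ij(1)] BH[OF that(2) ij(2)] that by simp
    show "r = r'"
    proof (cases r; cases r')
      fix a a' assume "r = Inl a" "r' = Inl a'"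
      then show ?thesis using r eq incomplete_array_row_unique[OF A ij, of a a'] by auto
    next
      fix a b assume "r = Inl a" "r' = Inr b"
      then show ?thesis using r eq AB[of a b] by auto
    next
      fix a b assume "r = Inr b" "r' = Inl a"
      then show ?thesis using r eq AB[of a b] by auto
    next
      fix b b' assume "r = Inr b" "r' = Inr b'"
      then show ?thesis using r eq BB[of b b'] by auto
    qed
  next
    fix i j x y assume ij: "i \<in> {1..k}" "j \<in> {1..k}" "i \<noteq> j" and xy: "x \<in> L" "y \<in> L"
    show "\<exists>r\<in>I <+> ?J. fill A B r i = x \<and> fill A B r j = y"
    proof (cases "x \<in> H \<and> y \<in> H")
      case True
      then obtain b where b: "b \<in> ?J" "B b i = x" "B b j = y"
        using orthogonal_array_row[OF B ij, of x y] by blast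
      then show ?thesis by (intro bexI[of _ "Inr b"]) (simp_all add: InrI)
    next
      case False
      then obtain a where a: "a \<in> I" "A a i = x" "A a j = y"
        using incomplete_array_row[OF A ij xy] by blast
      then show ?thesis by (intro bexI[of _ "Inl a"]) (simp_all add: InlI)
    qed
  qed (use fin in auto)
qed

lemma orthogonal_array_reindex:
  assumes A: "incomplete_array k L {} I A" and k: "k \<ge> 2"
  obtains g where "bij_betw g {1..(card L)\<^sup>2} I" "orthogonal_array k L (\<lambda>r. A (g r))"
proof -
  have fin: "finite L" using A by (simp add: incomplete_array_def)
  have "bij_betw (\<lambda>r. (A r 1, A r 2)) I (L \<times> L)"
    using incomplete_array_bij[OF A, of 1 2] k by simp
  then have "card I = (card L)\<^sup>2" "finite I"
    using fin by (simp_all add: bij_betw_same_card card_cartesian_product power2_eq_square bij_betw_finite)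
  then obtain g where g: "bij_betw g {1..(card L)\<^sup>2} I"
    by (metis ex_bij_betw_nat_finite_1)
  have gI: "g r \<in> I" if "r \<in> {1..(card L)\<^sup>2}" for r using bij_betw_apply[OF g that] .
  have "orthogonal_array k L (\<lambda>r. A (g r))"
    unfolding orthogonal_array_def
  proof (intro conjI ballI impI)
    fix r l assume r: "r \<in> {1..(card L)\<^sup>2}" and l: "l \<in> {1..k}"
    \<comment> \<open>\<open>incomplete_array\<close> speaks of pairs of distinct columns only, so a
      single entry is located in \<open>L\<close> with the help of a second column.\<close>
    have "(if l = 1 then 2 else 1) \<in> {1..k}" "(if l = 1 then 2 else 1) \<noteq> l" using k by auto
    then obtain j where "j \<in> {1..k}" "j \<noteq> l" by blast
    then show "A (g r) l \<in> L" using incomplete_array_pair[OF A gI[OF r] l, of j] by auto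
  next
    fix i j x y assume ij: "i \<in> {1..k}" "j \<in> {1..k}" "i \<noteq> j" and xy: "x \<in> L" "y \<in> L"
    obtain a where a: "a \<in> I" "A a i = x" "A a j = y"
      using incomplete_array_row[OF A ij xy] by blast
    then obtain r where r: "r \<in> {1..(card L)\<^sup>2}" "g r = a"
      using g by (metis bij_betw_imp_surj_on imageE)
    show "\<exists>!r. r \<in> {1..(card L)\<^sup>2} \<and> A (g r) i = x \<and> A (g r) j = y"
    proof (rule ex1I[of _ r])
      fix r' assume r': "r' \<in> {1..(card L)\<^sup>2} \<and> A (g r') i = x \<and> A (g r') j = y"
      then have "g r' = g r"
        using incomplete_array_row_unique[OF A ij gI[of r'] a(1)] a r by auto
      then show "r' = r" using g r' r by (metis bij_betw_imp_inj_on inj_onD)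
    qed (use a r in auto)
  qed (rule fin)
  with g show ?thesis using that by blast
qed

text \<open>After filling by \<open>B\<close>, each \<open>rho\<close> is the
  \<open>hole_perm\<close> of the outer rows followed by the \<open>rho\<close> of \<open>B\<close>,
  or by the identity when \<open>s\<close> is outside the hole. The outer rows thus contribute a
  vector \<open>T\<close> independent of \<open>B\<close>, and a filling with entries
  \<open>T + v\<close> gives \<open>T + (T + v) = v\<close>.\<close>

lemma realises_all_fill:
  assumes A: "incomplete_array k L H I A" and H: "realises_all k H" and k: "k \<ge> 2"
  shows "realises_all k L"
  unfolding realises_all_def
proof
  fix v :: "nat \<times> nat \<times> nat \<Rightarrow> bit"
  have fin: "finite L" and HL: "H \<subseteq> L" using A by (auto simp: incomplete_array_def)
  define T where "T = (\<lambda>(c, i, j). \<Sum>s\<in>L. perm_parity (hole_perm I A c i j s))"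
  obtain B where B: "orthogonal_array k H B"
    and tauB: "\<forall>(c, i, j)\<in>basic_triples k. tau H B c i j = T (c, i, j) + v (c, i, j)"
    using H[unfolded realises_all_def, rule_format, of "\<lambda>t. T t + v t"] by auto
  let ?J = "{1..(card H)\<^sup>2}"
  note F = incomplete_array_fill[OF A B]
  obtain g where g: "bij_betw g {1..(card L)\<^sup>2} (I <+> ?J)"
    and C: "orthogonal_array k L (\<lambda>r. fill A B (g r))"
    using orthogonal_array_reindex[OF F k] by blast
  define D where "D = (\<lambda>r. fill A B (g r))"
  have D: "orthogonal_array k L D" using C by (simp add: D_def)
  have "tau L D c i j = T (c, i, j) + tau H B c i j" if t: "(c, i, j) \<in> distinct_triples k" for c i j
  proof -
    have t: "c \<in> {1..k}" "i \<in> {1..k}" "j \<in> {1..k}" "c \<noteq> i" "c \<noteq> j"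
      using that by (auto simp: distinct_triples_def)
    have rho: "rho L D c i j s x = fill A B r j"
      if r: "r \<in> I <+> ?J" "fill A B r c = s" "fill A B r i = x" for s x r
    proof -
      obtain r' where "r' \<in> {1..(card L)\<^sup>2}" "g r' = r"
        using g r(1) by (metis bij_betw_imp_surj_on imageE)
      then show ?thesis
        using rho_apply[OF D t(1,2,4), of r' s j] r by (simp add: D_def)
    qed
    have rhoA: "rho L D c i j s x = A a j" "hole_perm I A c i j s x = A a j"
      if "a \<in> I" "A a c = s" "A a i = x" for s x a
      using rho[of "Inl a" s x] hole_perm_apply[OF A t(1,2,4) that, of j] that by (simp_all add: InlI)
    define E where "E = (\<lambda>s. if s \<in> H then rho H B c i j s else id)"
    have E_perm: "permutation (E s)" for s
      using rho_permutation[OF B t] by (simp add: E_def permutation_id)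
    have comp: "rho L D c i j s = E s \<circ> hole_perm I A c i j s" if s: "s \<in> L" for s
    proof
      fix x
      consider (row) a where "a \<in> I" "A a c = s" "A a i = x" | (hole) "s \<in> H" "x \<in> H" | (out) "x \<notin> L"
        using incomplete_array_row[OF A t(1,2,4) s, of x] by blast
      then show "rho L D c i j s x = (E s \<circ> hole_perm I A c i j s) x"
      proof cases
        case row
        have "E s (A a j) = A a j"
        proof (cases "s \<in> H")
          case True
          then have "A a j \<notin> H" using incomplete_array_pair[OF A row(1) t(1,3,5)] row by blast
          then show ?thesis by (simp add: E_def rho_def)
        qed (simp add: E_def)
        then show ?thesis using rhoA[OF row] by simp
      next
        case hole
        then obtain b where b: "b \<in> ?J" "B b c = s" "B b i = x"
          using orthogonal_array_row[OF B t(1,2,4)] by blast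
        have "\<not> (\<exists>a\<in>I. A a c = s \<and> A a i = x)"
          using incomplete_array_pair[OF A _ t(1,2,4)] hole by blast
        then have "hole_perm I A c i j s x = x" unfolding hole_perm_def by (rule if_not_P)
        moreover have "rho L D c i j s x = B b j"
          using rho[of "Inr b" s x] b by (simp add: InrI)
        moreover have "E s x = B b j"
          using rho_apply[OF B t(1,2,4) b(1,2), of j] b(3) hole by (simp add: E_def)
        ultimately show ?thesis by simp
      next
        case out
        have "\<not> (\<exists>a\<in>I. A a c = s \<and> A a i = x)"
          using incomplete_array_pair[OF A _ t(1,2,4)] out by blast
        then have "hole_perm I A c i j s x = x" unfolding hole_perm_def by (rule if_not_P)
        moreover have "x \<notin> H" using out HL by blast
        ultimately show ?thesis using out by (simp add: E_def rho_def)
      qed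
    qed
    have "perm_parity (rho L D c i j s) = perm_parity (hole_perm I A c i j s) + perm_parity (E s)"
      if s: "s \<in> L" for s
    proof -
      have bij: "bij (E s)" using E_perm by (rule permutation_bijective)
      \<comment> \<open>That \<open>hole_perm\<close> is a permutation is read off from the
        composition, whose other two members are permutations.\<close>
      have "inv (E s) \<circ> rho L D c i j s = hole_perm I A c i j s"
        unfolding comp[OF s] using bij by (simp add: fun_eq_iff bij_is_inj)
      then have "permutation (hole_perm I A c i j s)"
        using permutation_compose[OF permutation_inverse[OF E_perm] rho_permutation[OF D t s]] by metis
      then show ?thesis
        unfolding comp[OF s] using perm_parity_comp[OF E_perm] by (simp only: add.commute)
    qed
    then have "tau L D c i j = T (c, i, j) + (\<Sum>s\<in>L. perm_parity (E s))"
      by (simp add: tau_def T_def sum.distrib)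
    also have "(\<Sum>s\<in>L. perm_parity (E s)) = (\<Sum>s\<in>H. perm_parity (E s))"
      by (rule sum.mono_neutral_right[OF fin HL]) (simp add: E_def)
    also have "\<dots> = tau H B c i j"
      by (simp add: tau_def E_def)
    finally show ?thesis .
  qed
  note tauD = this
  have "\<forall>(c, i, j)\<in>basic_triples k. tau L D c i j = v (c, i, j)"
  proof clarify
    fix c i j assume t: "(c, i, j) \<in> basic_triples k"
    then have "tau H B c i j = T (c, i, j) + v (c, i, j)" using tauB by blast
    then show "tau L D c i j = v (c, i, j)"
      using tauD[OF subsetD[OF basic_triples_subset[OF k] t]] by simp
  qed
  with D show "\<exists>A. orthogonal_array k L A \<and> (\<forall>(c, i, j)\<in>basic_triples k. tau L A c i j = v (c, i, j))"
    by blast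
qed

subsection \<open>Linear arrays over the integers modulo m\<close>

definition det2 :: "(nat \<Rightarrow> int) \<Rightarrow> (nat \<Rightarrow> int) \<Rightarrow> nat \<Rightarrow> nat \<Rightarrow> int" where
  "det2 a b i j = a i * b j - a j * b i"

definition linear_entry :: "int \<Rightarrow> (nat \<Rightarrow> int) \<Rightarrow> (nat \<Rightarrow> int) \<Rightarrow> int \<times> int \<Rightarrow> nat \<Rightarrow> int" where
  "linear_entry m a b = (\<lambda>(x, y) l. (a l * x + b l * y) mod m)"

text \<open>Cramer's rule: the determinant times each coordinate of the difference of two rows is a
  combination of the two congruences, and the determinant is invertible modulo
  \<open>m\<close>.\<close>

lemma linear_entry_inj:
  assumes m: "m > 0" and cop: "coprime (det2 a b i j) m"
  shows "inj_on (\<lambda>p. (linear_entry m a b p i, linear_entry m a b p j)) ({0..<m} \<times> {0..<m})"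
proof (rule inj_onI)
  fix p q
  assume p: "p \<in> {0..<m} \<times> {0..<m}" and q: "q \<in> {0..<m} \<times> {0..<m}"
    and eq: "(linear_entry m a b p i, linear_entry m a b p j) = (linear_entry m a b q i, linear_entry m a b q j)"
  obtain x y x' y' where pq: "p = (x, y)" "q = (x', y')" by (cases p; cases q)
  have i: "m dvd (a i * x + b i * y) - (a i * x' + b i * y')"
    and j: "m dvd (a j * x + b j * y) - (a j * x' + b j * y')"
    using eq by (simp_all add: pq linear_entry_def mod_eq_dvd_iff)
  have "m dvd b j * ((a i * x + b i * y) - (a i * x' + b i * y')) - b i * ((a j * x + b j * y) - (a j * x' + b j * y'))"
    by (rule dvd_diff[OF dvd_mult[OF i] dvd_mult[OF j]])
  also have "\<dots> = det2 a b i j * (x - x')" by (simp add: det2_def algebra_simps)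
  finally have "m dvd x - x'" using cop by (metis coprime_commute coprime_dvd_mult_right_iff)
  then have x: "x = x'" using p q by (simp add: pq mod_eq_dvd_iff[symmetric])
  have "m dvd a i * ((a j * x + b j * y) - (a j * x' + b j * y')) - a j * ((a i * x + b i * y) - (a i * x' + b i * y'))"
    by (rule dvd_diff[OF dvd_mult[OF j] dvd_mult[OF i]])
  also have "\<dots> = det2 a b i j * (y - y')" by (simp add: det2_def algebra_simps)
  finally have "m dvd y - y'" using cop by (metis coprime_commute coprime_dvd_mult_right_iff)
  then have "y = y'" using p q by (simp add: pq mod_eq_dvd_iff[symmetric])
  with x show "p = q" by (simp add: pq)
qed

lemma linear_array:
  assumes m: "m > 0"
    and cop: "\<And>i j. i \<in> {1..k} \<Longrightarrow> j \<in> {1..k} \<Longrightarrow> i \<noteq> j \<Longrightarrow> coprime (det2 a b i j) m"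
  shows "incomplete_array k {0..<m} {} ({0..<m} \<times> {0..<m}) (linear_entry m a b)"
  unfolding incomplete_array_def
proof (intro conjI ballI impI)
  fix i j assume ij: "i \<in> {1..k}" "j \<in> {1..k}" "i \<noteq> j"
  let ?f = "\<lambda>p. (linear_entry m a b p i, linear_entry m a b p j)"
  have "?f ` ({0..<m} \<times> {0..<m}) \<subseteq> {0..<m} \<times> {0..<m}"
    using m by (auto simp: linear_entry_def)
  then have "?f ` ({0..<m} \<times> {0..<m}) = {0..<m} \<times> {0..<m}"
    by (intro endo_inj_surj linear_entry_inj m cop ij) auto
  then show "bij_betw ?f ({0..<m} \<times> {0..<m}) ({0..<m} \<times> {0..<m} - {} \<times> {})"
    using linear_entry_inj[OF m cop[OF ij]] by (simp add: bij_betw_def)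
qed auto

text \<open>The multiples of \<open>d\<close> form a subgroup of Z_m, so the linear forms map
  \<open>H \<times> H\<close> into itself; being injective on a finite set they do so onto, and
  these rows form a subarray.\<close>

lemma linear_array_hole:
  fixes d :: int
  assumes m: "m > 0" and d: "d dvd m"
    and cop: "\<And>i j. i \<in> {1..k} \<Longrightarrow> j \<in> {1..k} \<Longrightarrow> i \<noteq> j \<Longrightarrow> coprime (det2 a b i j) m"
  defines "H \<equiv> {x \<in> {0..<m}. d dvd x}"
  shows "incomplete_array k {0..<m} H ({0..<m} \<times> {0..<m} - H \<times> H) (linear_entry m a b)"
proof (rule incomplete_array_remove)
  show "incomplete_array k {0..<m} {} ({0..<m} \<times> {0..<m}) (linear_entry m a b)"
    using linear_array[OF m cop] by blast
next
  have finH: "finite H" unfolding H_def by (rule finite_subset[of _ "{0..<m}"]) auto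
  fix i j assume ij: "i \<in> {1..k}" "j \<in> {1..k}" "i \<noteq> j"
  have "(\<lambda>p. (linear_entry m a b p i, linear_entry m a b p j)) ` (H \<times> H) \<subseteq> H \<times> H"
    using m d by (auto simp: linear_entry_def H_def dvd_mod)
  moreover have "inj_on (\<lambda>p. (linear_entry m a b p i, linear_entry m a b p j)) (H \<times> H)"
    by (rule inj_on_subset[OF linear_entry_inj[OF m cop[OF ij]]]) (auto simp: H_def)
  ultimately show "(\<lambda>p. (linear_entry m a b p i, linear_entry m a b p j)) ` (H \<times> H) = H \<times> H"
    by (intro endo_inj_surj) (simp_all add: finH)
qed (auto simp: H_def)

text \<open>The columns are \<open>(1, 0), (0, 1), (1, 1), (1, 2), (1, 3), \<dots>\<close>.\<close>

lemma det2_standard: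
  assumes "\<And>p. 2 \<le> p \<Longrightarrow> p + 1 < int k \<Longrightarrow> coprime p m" "i \<in> {1..k}" "j \<in> {1..k}" "i \<noteq> j"
  shows "coprime (det2 (\<lambda>l. if l = 2 then 0 else 1) (\<lambda>l. if l = 1 then 0 else if l = 2 then 1 else int l - 2) i j) m"
    (is "coprime ?d m")
proof -
  \<comment> \<open>Up to sign the determinants are 1, \<open>j - 2\<close> or \<open>j - i\<close>
    with \<open>3 \<le> i < j \<le> k\<close>, hence at most \<open>k - 2\<close>.\<close>
  have "\<bar>?d\<bar> \<noteq> 0 \<and> (\<bar>?d\<bar> = 1 \<or> 2 \<le> \<bar>?d\<bar> \<and> \<bar>?d\<bar> + 1 < int k)"
    using assms(2-4) by (cases "i = 1"; cases "i = 2"; cases "j = 1"; cases "j = 2") (simp_all add: det2_def, linarith+)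
  then have "\<bar>?d\<bar> = 1 \<or> coprime \<bar>?d\<bar> m" using assms(1) by blast
  then have "coprime \<bar>?d\<bar> m" by (elim disjE) simp_all
  then show ?thesis by simp
qed

subsection \<open>Order 11\<close>

text \<open>The quadratic character in additive form: 0 on nonzero squares, 1 on non-squares.
  Multiples of 11 get the junk value 1.\<close>

definition chi11 :: "int \<Rightarrow> bit" where
  "chi11 a = (if a mod 11 \<in> {1, 3, 4, 5, 9} then 0 else 1)"

lemma coprime_11_cases:
  assumes "coprime (a :: int) 11"
  shows "a mod 11 \<in> {1, 2, 3, 4, 5, 6, 7, 8, 9, 10}"
proof -
  have "a mod 11 \<noteq> 0"
  proof
    assume "a mod 11 = 0"
    then have "11 dvd a" by presburger
    then show False using coprime_common_divisor[OF assms, of 11] by simp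
  qed
  moreover have "0 \<le> a mod 11" "a mod 11 < 11" by simp_all
  ultimately show ?thesis by simp presburger
qed

lemma chi11_mult:
  assumes "coprime a 11" "coprime b 11"
  shows "chi11 (a * b) = chi11 a + chi11 b"
proof -
  have "chi11 (a * b) = chi11 ((a mod 11) * (b mod 11))" by (simp add: chi11_def mod_mult_eq)
  moreover have "chi11 ((a mod 11) * (b mod 11)) = chi11 (a mod 11) + chi11 (b mod 11)"
    using coprime_11_cases[OF assms(1)] coprime_11_cases[OF assms(2)]
    by (elim insertE emptyE) (simp_all add: chi11_def)
  ultimately show ?thesis by (simp add: chi11_def)
qed

text \<open>As 11 = 3 modulo 4, -1 is a non-square; this is what makes the Paley relation a
  tournament.\<close>

lemma chi11_minus:
  assumes "coprime a 11"
  shows "chi11 (- a) = chi11 a + 1"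
  using chi11_mult[of "- 1" a] assms by (simp add: chi11_def add.commute)

section \<open>The parity of x -> m x + t modulo 11\<close>

definition affine11 :: "int \<Rightarrow> int \<Rightarrow> int \<Rightarrow> int" where
  "affine11 m t x = (if x \<in> {0..<11} then (m * x + t) mod 11 else x)"

lemma permutation_affine11:
  assumes "coprime m 11"
  shows "permutation (affine11 m t)"
proof -
  have inj: "inj_on (affine11 m t) {0..<11}"
  proof (rule inj_onI)
    fix x y assume xy: "x \<in> {0..<11}" "y \<in> {0..<11}" "affine11 m t x = affine11 m t y"
    then have "11 dvd m * (x - y)" by (simp add: affine11_def mod_eq_dvd_iff algebra_simps)
    then have "11 dvd x - y" using assms by (metis coprime_commute coprime_dvd_mult_right_iff)
    then show "x = y" using xy by (simp add: mod_eq_dvd_iff[symmetric])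
  qed
  moreover have "affine11 m t ` {0..<11} \<subseteq> {0..<11}" by (auto simp: affine11_def)
  ultimately have "affine11 m t ` {0..<11} = {0..<11}" by (intro endo_inj_surj) auto
  with inj have "affine11 m t permutes {0..<11}"
    by (intro bij_imp_permutes) (auto simp: bij_betw_def affine11_def)
  then show ?thesis by (intro permutes_imp_permutation) auto
qed

lemma affine11_comp: "affine11 m t \<circ> affine11 m' t' = affine11 (m * m') (m * t' + t)"
proof
  fix x
  have "(m * ((m' * x + t') mod 11) + t) mod 11 = (m * (m' * x + t') + t) mod 11"
    by (metis mod_add_left_eq mod_mult_right_eq)
  then show "(affine11 m t \<circ> affine11 m' t') x = affine11 (m * m') (m * t' + t) x"
    by (simp add: affine11_def algebra_simps)
qed

lemma affine11_cong:
  assumes "m mod 11 = m' mod 11" "t mod 11 = t' mod 11"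
  shows "affine11 m t = affine11 m' t'"
proof
  fix x
  have "(m * x + t) mod 11 = (m' * x + t') mod 11"
    using assms by (metis mod_add_cong mod_mult_cong)
  then show "affine11 m t x = affine11 m' t' x" by (simp add: affine11_def)
qed

text \<open>For \<open>m = q\<^sup>2\<close> with \<open>q \<noteq> -1\<close> modulo 11 the affine map is the square of \<open>x \<mapsto> q x + t / (q + 1)\<close>.\<close>

lemma affine11_even:
  assumes "chi11 m = 0"
  shows "perm_parity (affine11 m t) = 0"
proof -
  have sq: ?thesis if "q * q mod 11 = m mod 11" "(q + 1) * u mod 11 = 1" "coprime q 11" for q u
  proof -
    have "(q * (u * t) + u * t) mod 11 = ((q + 1) * u mod 11) * t mod 11"
      unfolding mod_mult_left_eq by (simp add: algebra_simps)
    then have "(q * (u * t) + u * t) mod 11 = t mod 11" using that(2) by simp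
    then have "affine11 m t = affine11 q (u * t) \<circ> affine11 q (u * t)"
      unfolding affine11_comp by (intro affine11_cong) (use that in auto)
    then show ?thesis
      using perm_parity_comp[OF permutation_affine11 permutation_affine11, OF that(3) that(3)] by simp
  qed
  have cop: "coprime (q :: int) 11" if "\<bar>q * w mod 11\<bar> = 1" for q w
  proof (rule coprimeI)
    fix c assume "c dvd q" "c dvd 11"
    then have "c dvd q * w mod 11" by (simp add: dvd_mod)
    then show "is_unit c" using that by (metis dvd_abs_iff)
  qed
  \<comment> \<open>For \<open>m\<close> = 1, 3, 4, 5, 9 in turn, \<open>q\<close> is a square root
    of \<open>m\<close> other than -1 and \<open>u\<close> the inverse of \<open>q + 1\<close>
    modulo 11. The second argument of \<open>cop\<close> is the inverse of \<open>q\<close>.\<close>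
  have "m mod 11 \<in> {1, 3, 4, 5, 9}" using assms by (auto simp: chi11_def split: if_splits)
  then show ?thesis
    by (elim insertE emptyE)
      (rule sq[of 1 6] sq[of 5 2] sq[of 2 4] sq[of 4 9] sq[of 3 3]; simp add: cop[of 5 9] cop[of 2 6] cop[of 4 3] cop[of 3 4])+
qed

lemma perm_parity_transpose:
  "a \<noteq> b \<Longrightarrow> permutation p \<Longrightarrow> perm_parity (transpose a b \<circ> p) = 1 + perm_parity p"
  by (simp add: perm_parity_comp permutation_swap_id del: o_apply) (simp add: perm_parity_def evenperm_swap)

text \<open>Negation fixes 0 and exchanges x with 11 - x: five transpositions.\<close>

lemma affine11_neg: "perm_parity (affine11 (- 1) 0) = 1"
proof -
  let ?p = "transpose 1 10 \<circ> (transpose 2 9 \<circ> (transpose 3 8 \<circ> (transpose 4 7 \<circ> (transpose 5 6 \<circ> id))))"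
  have "affine11 (- 1) 0 = ?p"
  proof
    fix x :: int
    show "affine11 (- 1) 0 x = ?p x"
    proof (cases "x \<in> {0..<11}")
      case True
      then have "x \<in> {0, 1, 2, 3, 4, 5, 6, 7, 8, 9, 10}" by simp presburger
      then show ?thesis by (elim insertE emptyE) (simp_all add: affine11_def transpose_def)
    next
      case False
      then have "x \<noteq> 1" "x \<noteq> 2" "x \<noteq> 3" "x \<noteq> 4" "x \<noteq> 5" "x \<noteq> 6" "x \<noteq> 7" "x \<noteq> 8" "x \<noteq> 9" "x \<noteq> 10"
        by auto
      moreover have "affine11 (- 1) 0 x = x" using False by (simp only: affine11_def if_False)
      ultimately show ?thesis by (simp add: transpose_def)
    qed
  qed
  then show ?thesis
    by (simp add: perm_parity_transpose permutation_compose permutation_swap_id permutation_id del: o_apply o_id comp_id)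
qed

lemma affine11_parity:
  assumes "coprime m 11"
  shows "perm_parity (affine11 m t) = chi11 m"
proof (cases "chi11 m = 0")
  case True
  then show ?thesis using affine11_even by simp
next
  case False
  \<comment> \<open>For a non-square \<open>m\<close>, the factor \<open>- m\<close> is a square and
    hence even, so the parity is that of negation.\<close>
  have "affine11 m t = affine11 (- m) t \<circ> affine11 (- 1) 0" unfolding affine11_comp by simp
  then have "perm_parity (affine11 m t) = perm_parity (affine11 (- m) t) + perm_parity (affine11 (- 1) 0)"
    using perm_parity_comp[OF permutation_affine11 permutation_affine11, of "- m" "- 1" t 0] assms by simp
  moreover have "chi11 (- m) = 0" using chi11_minus[OF assms] False by simp
  ultimately show ?thesis using False affine11_even affine11_neg by simp
qed

text \<open>Three linear forms in two variables satisfy det(c,i) l_j = det(c,j) l_i - det(i,j) l_c.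
  On the rows with l_c = s the map from l_i to l_j is therefore affine with slope det(c,j) /
  det(c,i). Its parity does not depend on \<open>s\<close>, and the number 11 of summands is
  odd.\<close>

lemma tau_linear11:
  assumes A: "orthogonal_array k {0..<11} (\<lambda>r. linear_entry 11 a b (g r))"
    and t: "c \<in> {1..k}" "i \<in> {1..k}" "j \<in> {1..k}" "c \<noteq> i" "c \<noteq> j" "i \<noteq> j"
    and cop: "coprime (det2 a b c i) 11" "coprime (det2 a b c j) 11"
  shows "tau {0..<11} (\<lambda>r. linear_entry 11 a b (g r)) c i j = chi11 (det2 a b c i) + chi11 (det2 a b c j)"
proof -
  let ?L = "{0..<11::int}" and ?A = "\<lambda>r. linear_entry 11 a b (g r)"
  obtain e where e: "e * det2 a b c i mod 11 = 1"
  proof -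
    obtain u v where "u * det2 a b c i + v * 11 = 1"
      using bezout_int[of "det2 a b c i" 11] cop(1) by (auto simp: coprime_iff_gcd_eq_1)
    then have "u * det2 a b c i = 1 + (- v) * 11" by simp
    then have "u * det2 a b c i mod 11 = 1" by (simp only: mod_mult_self1) simp
    then show ?thesis using that by blast
  qed
  have cope: "coprime e 11"
  proof (rule coprimeI)
    fix d assume "d dvd e" "d dvd 11"
    then have "d dvd e * det2 a b c i mod 11" by (simp add: dvd_mod)
    then show "is_unit d" using e by simp
  qed
  have chie: "chi11 e = chi11 (det2 a b c i)"
  proof -
    have "chi11 e + chi11 (det2 a b c i) = chi11 1"
      unfolding chi11_mult[OF cope cop(1), symmetric] using e by (simp add: chi11_def)
    then have "chi11 e + chi11 (det2 a b c i) = 0" by (simp add: chi11_def)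
    then show ?thesis by (cases "chi11 e"; cases "chi11 (det2 a b c i)") auto
  qed
  have "rho ?L ?A c i j s = affine11 (e * det2 a b c j) (- e * det2 a b i j * s)" if s: "s \<in> ?L" for s
  proof
    fix x
    show "rho ?L ?A c i j s x = affine11 (e * det2 a b c j) (- e * det2 a b i j * s) x"
    proof (cases "x \<in> ?L")
      case True
      obtain r where r: "r \<in> {1..(card ?L)\<^sup>2}" "?A r c = s" "?A r i = x"
        using orthogonal_array_row[OF A t(1,2,4) s True] by blast
      obtain y z where yz: "g r = (y, z)" by (cases "g r")
      let ?l = "\<lambda>l. a l * y + b l * z"
      have l: "?A r l = ?l l mod 11" for l by (simp add: yz linear_entry_def)
      have "det2 a b c i * ?l j = det2 a b c j * ?l i - det2 a b i j * ?l c"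
        by (simp add: det2_def algebra_simps)
      from arg_cong[OF this, of "\<lambda>z. e * z"]
      have "e * det2 a b c i * ?l j = e * det2 a b c j * ?l i + (- e * det2 a b i j) * ?l c"
        by (simp add: algebra_simps)
      moreover have "e * det2 a b c i * ?l j mod 11 = ?l j mod 11"
        using e by (metis mod_mult_left_eq mult_1)
      ultimately have "?l j mod 11 = (e * det2 a b c j * ?l i + (- e * det2 a b i j) * ?l c) mod 11"
        by simp
      also have "\<dots> = (e * det2 a b c j * (?l i mod 11) + (- e * det2 a b i j) * (?l c mod 11)) mod 11"
        by (metis mod_add_eq mod_mult_right_eq)
      finally have "?A r j = (e * det2 a b c j * x + (- e * det2 a b i j) * s) mod 11"
        using r l by simp
      moreover have "rho ?L ?A c i j s x = ?A r j"
        using rho_apply[OF A t(1,2,4) r(1,2), of j] r(3) by simp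
      ultimately show ?thesis using True by (simp only: affine11_def if_True)
    next
      case False
      then show ?thesis by (simp only: rho_def affine11_def if_False)
    qed
  qed
  moreover have "perm_parity (affine11 (e * det2 a b c j) u) = chi11 (det2 a b c i) + chi11 (det2 a b c j)" for u
    using affine11_parity[of "e * det2 a b c j" u] chi11_mult[OF cope cop(2)] chie cope cop(2) by simp
  ultimately have "tau ?L ?A c i j = (\<Sum>s\<in>?L. chi11 (det2 a b c i) + chi11 (det2 a b c j))"
    unfolding tau_def by (intro sum.cong) simp_all
  then show ?thesis by (cases "chi11 (det2 a b c i) + chi11 (det2 a b c j)") simp_all
qed

text \<open>The Paley tournament of order 11 contains every labelled tournament on four vertices, one of them \<open>0\<close>.\<close>

definition paley11_witnesses :: "(int \<times> int \<times> int) list" where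
  "paley11_witnesses = [
    (2, 8, 10), (2, 10, 8), (2, 8, 7), (2, 8, 6), (2, 6, 8), (2, 6, 10), (2, 7, 6), (2, 6, 7),
    (2, 8, 4), (2, 8, 1), (2, 8, 3), (2, 10, 3), (2, 6, 1), (2, 6, 4), (2, 6, 3), (2, 7, 5),
    (2, 1, 8), (2, 1, 10), (2, 1, 7), (2, 1, 6), (2, 3, 10), (2, 3, 8), (2, 5, 7), (2, 3, 6),
    (2, 1, 9), (2, 1, 4), (2, 1, 3), (2, 1, 5), (2, 3, 9), (2, 3, 1), (2, 3, 5), (2, 5, 3),
    (1, 8, 7), (1, 7, 8), (1, 7, 2), (1, 7, 10), (1, 2, 8), (1, 2, 7), (1, 2, 10), (1, 2, 6),
    (1, 7, 3), (1, 8, 9), (1, 7, 4), (1, 7, 5), (1, 2, 9), (1, 2, 3), (1, 2, 4), (1, 2, 5),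
    (1, 9, 8), (1, 3, 7), (1, 3, 2), (1, 3, 6), (1, 5, 7), (1, 4, 7), (1, 4, 6), (1, 4, 2),
    (1, 3, 9), (1, 9, 3), (1, 3, 5), (1, 3, 4), (1, 4, 3), (1, 4, 9), (1, 5, 4), (1, 4, 5)]"

text \<open>The 64 triples match the 64 orientations of the six arcs on 0, \<open>a\<close>,
  \<open>b\<close>, \<open>c\<close>. Multiplication by a nonzero square preserves a pattern, which
  is why the first entry can be normalised to 1 (a square) or 2 (a non-square).\<close>

lemma paley11_patterns: "set (List.n_lists 6 [True, False]) \<subseteq> set (
  map (\<lambda>(a, b, c). map (\<lambda>x. x mod 11 \<in> {1, 3, 4, 5, 9}) [a, b, c, b - a, c - a, c - b]) paley11_witnesses)"
  unfolding paley11_witnesses_def by code_simp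
lemma paley11_witnesses_range:
  "(a, b, c) \<in> set paley11_witnesses \<Longrightarrow> {a, b, c} \<subseteq> {1..10} \<and> distinct [a, b, c]"
  unfolding paley11_witnesses_def by auto

lemma coprime_11I:
  fixes n :: int
  assumes "n mod 11 \<noteq> 0"
  shows "coprime n 11"
proof -
  have "0 \<le> n mod 11" "n mod 11 < 11" by simp_all
  with assms have "n mod 11 \<in> {1, 2, 3, 4, 5, 6, 7, 8, 9, 10}" by simp presburger
  then have "gcd (n mod 11) 11 = 1" by (elim insertE emptyE) (simp_all add: gcd_non_0_int)
  then show ?thesis by (simp add: coprime_iff_gcd_eq_1 gcd.commute flip: gcd_red_int)
qed

lemma paley11:
  fixes x y z p q r :: bit
  obtains a b c :: int where
    "chi11 a = x" "chi11 b = y" "chi11 c = z" "chi11 (b - a) = p" "chi11 (c - a) = q" "chi11 (c - b) = r"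
    "coprime a 11" "coprime b 11" "coprime c 11"
    "coprime (b - a) 11" "coprime (c - a) 11" "coprime (c - b) 11"
proof -
  have "[x = 0, y = 0, z = 0, p = 0, q = 0, r = 0] \<in> set (List.n_lists 6 [True, False])"
    by (auto simp: set_n_lists)
  from subsetD[OF paley11_patterns this]
  obtain t where t: "t \<in> set paley11_witnesses" and
    "(\<lambda>(a, b, c). map (\<lambda>x. x mod 11 \<in> {1, 3, 4, 5, 9}) [a, b, c, b - a, c - a, c - b]) t =
      [x = 0, y = 0, z = 0, p = 0, q = 0, r = 0]"
    unfolding set_map by (elim imageE) (rule that, assumption, rule sym)
  moreover obtain a b c where "t = (a, b, c)" by (cases t)
  ultimately have w: "(a, b, c) \<in> set paley11_witnesses"
    and eq: "map (\<lambda>x. x mod 11 \<in> {1, 3, 4, 5, 9}) [a, b, c, b - a, c - a, c - b] =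
      [x = 0, y = 0, z = 0, p = 0, q = 0, r = 0]"
    by (simp_all only: prod.case)
  have chi: "chi11 n = u" if "(n mod 11 \<in> {1, 3, 4, 5, 9}) = (u = 0)" for n u
    using that by (cases u) (simp_all add: chi11_def)
  have range: "a \<in> {1..10}" "b \<in> {1..10}" "c \<in> {1..10}" "a \<noteq> b" "a \<noteq> c" "b \<noteq> c"
    using paley11_witnesses_range[OF w] by auto
  have cop: "coprime (m - n) 11" if "m \<in> {0..10}" "n \<in> {0..10}" "m \<noteq> n" for m n :: int
    by (rule coprime_11I) (use that in \<open>auto simp: mod_eq_0_iff_dvd mod_eq_dvd_iff[symmetric]\<close>)
  have cop': "coprime a 11" "coprime b 11" "coprime c 11"
      "coprime (b - a) 11" "coprime (c - a) 11" "coprime (c - b) 11"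
    using range cop[of a 0] cop[of b 0] cop[of c 0] cop[of b a] cop[of c a] cop[of c b] by simp_all
  have "chi11 a = x" "chi11 b = y" "chi11 c = z" "chi11 (b - a) = p" "chi11 (c - a) = q" "chi11 (c - b) = r"
    using eq by (intro chi; simp only: list.map list.inject)+
  then show ?thesis using that cop' by blast
qed

text \<open>The columns are (1,0), (0,1) and \<beta> (\<alpha>, 1) with a sign \<beta> and a slope
  \<alpha> for each of columns 3 to 5. By \<open>tau_linear11\<close> the entries at (1;2,j),
  (2;1,j), (c;1,j) are chi(\<beta>_j), chi(\<beta>_j) + chi(\<alpha>_j) and chi(\<beta>_j) +
  chi(\<alpha>_j - \<alpha>_c). So the signs settle the first kind, and the other six values
  prescribe a tournament on 0 and the three slopes.\<close>

lemma realises_all_11: "realises_all 5 {0..<11::int}"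
  unfolding realises_all_def
proof
  fix v :: "nat \<times> nat \<times> nat \<Rightarrow> bit"
  define x where "x = (\<lambda>j. v (1, 2, j))"
  obtain a3 a4 a5 where chi_a:
      "chi11 a3 = v (2, 1, 3) + x 3" "chi11 a4 = v (2, 1, 4) + x 4" "chi11 a5 = v (2, 1, 5) + x 5"
      "chi11 (a4 - a3) = v (3, 1, 4) + x 4" "chi11 (a5 - a3) = v (3, 1, 5) + x 5" "chi11 (a5 - a4) = v (4, 1, 5) + x 5"
    and cop_a: "coprime a3 11" "coprime a4 11" "coprime a5 11"
      "coprime (a4 - a3) 11" "coprime (a5 - a3) 11" "coprime (a5 - a4) 11"
    using paley11[of "v (2, 1, 3) + x 3" "v (2, 1, 4) + x 4" "v (2, 1, 5) + x 5"
        "v (3, 1, 4) + x 4" "v (3, 1, 5) + x 5" "v (4, 1, 5) + x 5"] by blast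
  define \<alpha> where "\<alpha> = (\<lambda>l::nat. if l = 3 then a3 else if l = 4 then a4 else a5)"
  define \<beta> where "\<beta> = (\<lambda>l. if x l = 0 then 1 else - 1 :: int)"
  define a where "a = (\<lambda>l::nat. if l = 1 then 1 else if l = 2 then 0 else \<beta> l * \<alpha> l)"
  define b where "b = (\<lambda>l::nat. if l = 1 then 0 else if l = 2 then 1 else \<beta> l)"
  have \<beta>: "coprime (\<beta> l) 11" "chi11 (\<beta> l) = x l" for l by (auto simp: \<beta>_def chi11_def)
  have idx: "l = 3 \<or> l = 4 \<or> l = 5" if "l \<in> {3..5}" for l :: nat using that by auto
  have \<alpha>: "coprime (\<alpha> l) 11" "chi11 (\<alpha> l) = v (2, 1, l) + x l" if "l \<in> {3..5}" for l
    using idx[OF that] cop_a chi_a by (auto simp: \<alpha>_def)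
  have \<alpha>2: "coprime (\<alpha> j - \<alpha> i) 11 \<and> chi11 (\<alpha> j - \<alpha> i) = v (i, 1, j) + x j"
    if "i \<in> {3..5}" "j \<in> {i<..5}" for i j
  proof -
    have "i = 3 \<and> j = 4 \<or> i = 3 \<and> j = 5 \<or> i = 4 \<and> j = 5" using that by auto
    then show ?thesis using cop_a chi_a by (auto simp: \<alpha>_def)
  qed
  have d12: "det2 a b 1 2 = 1" "det2 a b 2 1 = - 1" by (simp_all add: det2_def a_def b_def)
  have dj: "det2 a b 1 j = \<beta> j" "det2 a b j 1 = - \<beta> j" "det2 a b 2 j = - (\<beta> j * \<alpha> j)" "det2 a b j 2 = \<beta> j * \<alpha> j"
    if "j \<in> {3..5}" for j
    using that by (auto simp: det2_def a_def b_def)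
  have dij: "det2 a b i j = - (\<beta> i * \<beta> j * (\<alpha> j - \<alpha> i))" "det2 a b j i = \<beta> i * \<beta> j * (\<alpha> j - \<alpha> i)"
    if "i \<in> {3..5}" "j \<in> {3..5}" for i j
    using that by (auto simp: det2_def a_def b_def algebra_simps)
  have cop: "coprime (det2 a b i j) 11" if ij: "i \<in> {1..5}" "j \<in> {1..5}" "i \<noteq> j" for i j
  proof -
    have *: "i = 1 \<or> i = 2 \<or> i \<in> {3..5}" "j = 1 \<or> j = 2 \<or> j \<in> {3..5}" using ij by auto
    have "coprime (det2 a b i j) 11" if "i \<in> {3..5}" "j \<in> {3..5}"
    proof (cases "i < j")
      case True
      then show ?thesis using \<alpha>2[of i j] \<beta> that by (simp add: dij(1))
    next
      case False
      then show ?thesis using \<alpha>2[of j i] \<beta> that ij by (simp add: dij(2))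
    qed
    with * \<alpha> \<beta> ij(3) show ?thesis by (elim disjE) (simp_all add: d12 dj del: One_nat_def)
  qed
  obtain g where A: "orthogonal_array 5 {0..<11} (\<lambda>r. linear_entry 11 a b (g r))"
  proof (rule orthogonal_array_reindex)
    show "incomplete_array 5 {0..<11} {} ({0..<11} \<times> {0..<11}) (linear_entry 11 a b)"
      by (rule linear_array) (use cop in simp_all)
  qed simp_all
  have tau: "tau {0..<11} (\<lambda>r. linear_entry 11 a b (g r)) c i j = chi11 (det2 a b c i) + chi11 (det2 a b c j)"
    if "(c, i, j) \<in> distinct_triples 5" for c i j
    using that by (intro tau_linear11[OF A] cop) (auto simp: distinct_triples_def)
  have chi1: "chi11 1 = 0" "chi11 (- 1) = 1" by (simp_all add: chi11_def)
  have "tau {0..<11} (\<lambda>r. linear_entry 11 a b (g r)) c i j = v (c, i, j)"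
    if t: "(c, i, j) \<in> basic_triples 5" for c i j
  proof -
    consider (one) "c = 1" "i = 2" "j \<in> {3..5}" | (two) "c = 2" "i = 1" "j \<in> {3..5}"
      | (three) "c \<in> {3..5}" "i = 1" "j \<in> {c<..5}"
      using t by (auto simp: basic_triples_def)
    then have "chi11 (det2 a b c i) + chi11 (det2 a b c j) = v (c, i, j)"
    proof cases
      case one
      then show ?thesis using \<beta> by (simp add: d12 dj chi1 x_def del: One_nat_def)
    next
      case two
      have "chi11 (- (\<beta> j * \<alpha> j)) = x j + (v (2, 1, j) + x j) + 1"
        using chi11_minus[of "\<beta> j * \<alpha> j"] chi11_mult[of "\<beta> j" "\<alpha> j"] \<alpha>[OF two(3)] \<beta> by simp
      then show ?thesis using two
        by (cases "x j"; cases "v (2, 1, j)") (simp_all add: d12 dj chi1 del: One_nat_def)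
    next
      case three
      have j: "j \<in> {3..5}" using three by auto
      have "chi11 (- (\<beta> c * \<beta> j * (\<alpha> j - \<alpha> c))) = x c + x j + (v (c, 1, j) + x j) + 1"
        using chi11_minus[of "\<beta> c * \<beta> j * (\<alpha> j - \<alpha> c)"] chi11_mult[of "\<beta> c * \<beta> j" "\<alpha> j - \<alpha> c"]
          chi11_mult[of "\<beta> c" "\<beta> j"] \<alpha>2[OF three(1,3)] \<beta> by simp
      moreover have "chi11 (- \<beta> c) = x c + 1" using chi11_minus \<beta> by simp
      ultimately show ?thesis using three j
        by (cases "x j"; cases "x c"; cases "v (c, 1, j)") (simp_all add: dj dij(1) del: One_nat_def)
    qed
    then show ?thesis using tau[OF subsetD[OF basic_triples_subset t]] by simp
  qed
  with A show "\<exists>A. orthogonal_array 5 {0..<11::int} A \<and>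
      (\<forall>(c, i, j)\<in>basic_triples 5. tau {0..<11} A c i j = v (c, i, j))" by blast
qed

subsection \<open>Wilson's construction\<close>

lemma incomplete_array_map:
  assumes A: "incomplete_array k L H I A" and f: "bij_betw f L L'"
  shows "incomplete_array k L' (f ` H) I (\<lambda>r l. f (A r l))"
  unfolding incomplete_array_def
proof (intro conjI ballI impI)
  have inj: "inj_on f L" and im: "f ` L = L'" using f by (auto simp: bij_betw_def)
  have HL: "H \<subseteq> L" using A by (auto simp: incomplete_array_def)
  fix i j assume ij: "i \<in> {1..k}" "j \<in> {1..k}" "i \<noteq> j"
  have "bij_betw (map_prod f f) (L \<times> L) (L' \<times> L')"
    using f by (rule bij_betw_map_prod[OF _ f])
  moreover have "bij_betw (map_prod f f) (H \<times> H) (f ` H \<times> f ` H)"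
    using inj HL by (intro bij_betw_map_prod) (auto simp: bij_betw_def inj_on_subset)
  ultimately have "bij_betw (map_prod f f) (L \<times> L - H \<times> H) (L' \<times> L' - f ` H \<times> f ` H)"
    by (rule bij_betw_DiffI) (use HL im in auto)
  from bij_betw_trans[OF incomplete_array_bij[OF A ij] this]
  show "bij_betw (\<lambda>r. (f (A r i), f (A r j))) I (L' \<times> L' - f ` H \<times> f ` H)"
    by (simp add: comp_def)
qed (use A f in \<open>auto simp: incomplete_array_def bij_betw_def\<close>)

text \<open>
  Each row of the master array \<open>A\<close> is blown up by \<open>B\<close>, or by \<open>C\<close> with the point \<open>w\<close> identified with
  the last entry of the row if that entry belongs to the hole \<open>U\<close>.
\<close>

definition wilson_entry ::
    "nat \<Rightarrow> 'm \<Rightarrow> ('r \<Rightarrow> nat \<Rightarrow> 't) \<Rightarrow> ('s \<Rightarrow> nat \<Rightarrow> 'm) \<Rightarrow> ('e \<Rightarrow> nat \<Rightarrow> 'm) \<Rightarrow>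
      ('r \<times> 's) + ('r \<times> 'e) \<Rightarrow> nat \<Rightarrow> ('t \<times> 'm) + 't" where
  "wilson_entry k w A B C = (\<lambda>p l. case p of
      Inl (r, s) \<Rightarrow> Inl (A r l, B s l)
    | Inr (r, e) \<Rightarrow> if C e l = w then Inr (A r (Suc k)) else Inl (A r l, C e l))"

text \<open>Two entries in \<open>T \<times> M\<close> determine \<open>r\<close> through columns
  \<open>i\<close> and \<open>j\<close>, and then a row of \<open>B\<close> or \<open>C\<close>. An
  entry in \<open>T \<times> M\<close> and one in \<open>U\<close> determine \<open>r\<close>
  through one of these columns and the last column, and then the row of \<open>C\<close> pairing
  \<open>w\<close> with the given point of \<open>M\<close>. The hole \<open>{w}\<close> of
  \<open>C\<close> leaves exactly the pairs from \<open>U\<close> uncovered.\<close>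

lemma incomplete_array_wilson:
  assumes A: "incomplete_array (Suc k) T {} I A" and U: "U \<subseteq> T"
    and B: "incomplete_array k M {} J B"
    and C: "incomplete_array k (insert w M) {w} K C" and w: "w \<notin> M"
  shows "incomplete_array k ((T \<times> M) <+> U) (Inr ` U)
    (({r\<in>I. A r (Suc k) \<notin> U} \<times> J) <+> ({r\<in>I. A r (Suc k) \<in> U} \<times> K)) (wilson_entry k w A B C)"
    (is "incomplete_array k ?L ?H ?I ?W")
proof (rule incomplete_arrayI)
  have fin: "finite T" "finite M" using A B by (auto simp: incomplete_array_def)
  then show "finite ?L" using finite_subset[OF U] by simp
  show "?H \<subseteq> ?L" by auto
next
  fix i j p assume ij: "i \<in> {1..k}" "j \<in> {1..k}" "i \<noteq> j" and p: "p \<in> ?I"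
  from p show "?W p i \<in> ?L \<and> ?W p j \<in> ?L \<and> \<not> (?W p i \<in> ?H \<and> ?W p j \<in> ?H)"
  proof (rule PlusE)
    fix q assume "q \<in> {r\<in>I. A r (Suc k) \<notin> U} \<times> J" "p = Inl q"
    then obtain r s where rs: "p = Inl (r, s)" "r \<in> I" "s \<in> J" by auto
    have "A r i \<in> T \<and> A r j \<in> T" "B s i \<in> M \<and> B s j \<in> M"
      using incomplete_array_pair[OF A rs(2), of i j] incomplete_array_pair[OF B rs(3) ij] ij by auto
    then show ?thesis by (auto simp: rs wilson_entry_def)
  next
    fix q assume "q \<in> {r\<in>I. A r (Suc k) \<in> U} \<times> K" "p = Inr q"
    then obtain r e where re: "p = Inr (r, e)" "r \<in> I" "e \<in> K" "A r (Suc k) \<in> U" by auto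
    have "A r i \<in> T \<and> A r j \<in> T"
      "C e i \<in> insert w M \<and> C e j \<in> insert w M \<and> \<not> (C e i \<in> {w} \<and> C e j \<in> {w})"
      using incomplete_array_pair[OF A re(2), of i j] incomplete_array_pair[OF C re(3) ij] ij by auto
    then show ?thesis using re(4) by (auto simp: re(1) wilson_entry_def)
  qed
next
  fix i j p p' assume ij: "i \<in> {1..k}" "j \<in> {1..k}" "i \<noteq> j" and p: "p \<in> ?I" "p' \<in> ?I"
    and eq: "?W p i = ?W p' i" "?W p j = ?W p' j"
  have uA: "r = r'" if "r \<in> I" "r' \<in> I" "A r a = A r' a" "A r b = A r' b"
    "a \<in> {1..Suc k}" "b \<in> {1..Suc k}" "a \<noteq> b" for r r' a b
    using incomplete_array_row_unique[OF A that(5-7,1-4)] .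
  have ij': "i \<in> {1..Suc k}" "j \<in> {1..Suc k}" "Suc k \<in> {1..Suc k}" "i \<noteq> Suc k" "j \<noteq> Suc k"
    using ij by auto
  have ww: "C e i \<noteq> w \<or> C e j \<noteq> w" if "e \<in> K" for e
    using incomplete_array_pair[OF C that ij] by auto
  \<comment> \<open>Agreement in both columns would make the two rows of \<open>A\<close> equal,
    though their last entries lie on different sides of \<open>U\<close>.\<close>
  have mixed: False if "r \<in> I" "A r (Suc k) \<notin> U" "r' \<in> I" "A r' (Suc k) \<in> U" "e \<in> K"
    "?W (Inl (r, s)) i = ?W (Inr (r', e)) i" "?W (Inl (r, s)) j = ?W (Inr (r', e)) j" for r r' s e
    using uA[OF that(1,3) _ _ ij'(1,2) ij(3)] that by (auto simp: wilson_entry_def split: if_splits)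
  consider (BB) r s r' s' where "p = Inl (r, s)" "p' = Inl (r', s')" "r \<in> I" "r' \<in> I" "s \<in> J" "s' \<in> J"
    | (BC) r s r' e where "p = Inl (r, s)" "p' = Inr (r', e)" "r \<in> I" "r' \<in> I" "e \<in> K"
        "A r (Suc k) \<notin> U" "A r' (Suc k) \<in> U"
    | (CB) r s r' e where "p' = Inl (r, s)" "p = Inr (r', e)" "r \<in> I" "r' \<in> I" "e \<in> K"
        "A r (Suc k) \<notin> U" "A r' (Suc k) \<in> U"
    | (CC) r e r' e' where "p = Inr (r, e)" "p' = Inr (r', e')" "r \<in> I" "r' \<in> I" "e \<in> K" "e' \<in> K"
    using p by (elim PlusE) auto
  then show "p = p'"
  proof cases
    case BB
    have "A r i = A r' i" "A r j = A r' j" "B s i = B s' i" "B s j = B s' j"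
      using eq by (auto simp: BB wilson_entry_def)
    then show ?thesis
      using uA[OF BB(3,4) _ _ ij'(1,2) ij(3)] incomplete_array_row_unique[OF B ij BB(5,6)] BB(1,2) by simp
  next
    case BC
    then show ?thesis using mixed[OF BC(3,6,4,7,5)] eq by simp
  next
    case CB
    then show ?thesis using mixed[OF CB(3,6,4,7,5), of s] eq[symmetric] by simp
  next
    case CC
    have C_eq: "C e i = C e' i" "C e j = C e' j"
      using eq by (auto simp: CC wilson_entry_def split: if_splits)
    have "r = r'"
    proof -
      consider "C e i = w" "C e j \<noteq> w" | "C e i \<noteq> w" "C e j = w" | "C e i \<noteq> w" "C e j \<noteq> w"
        using ww[OF CC(5)] by blast
      then show ?thesis
      proof cases
        case 1
        then have "A r (Suc k) = A r' (Suc k)" "A r j = A r' j"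
          using eq C_eq by (simp_all add: CC wilson_entry_def)
        then show ?thesis using uA[OF CC(3,4) _ _ ij'(3,2)] ij'(5) by metis
      next
        case 2
        then have "A r (Suc k) = A r' (Suc k)" "A r i = A r' i"
          using eq C_eq by (simp_all add: CC wilson_entry_def)
        then show ?thesis using uA[OF CC(3,4) _ _ ij'(3,1)] ij'(4) by metis
      next
        case 3
        then have "A r i = A r' i" "A r j = A r' j"
          using eq C_eq by (simp_all add: CC wilson_entry_def)
        then show ?thesis using uA[OF CC(3,4) _ _ ij'(1,2) ij(3)] by blast
      qed
    qed
    then show ?thesis
      using incomplete_array_row_unique[OF C ij CC(5,6) C_eq] CC(1,2) by simp
  qed
next
  fix i j x y assume ij: "i \<in> {1..k}" "j \<in> {1..k}" "i \<noteq> j" and xy: "x \<in> ?L" "y \<in> ?L"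
    and out: "\<not> (x \<in> ?H \<and> y \<in> ?H)"
  have row: "\<exists>r\<in>I. A r a = t \<and> A r b = t'" if "a \<in> {1..Suc k}" "b \<in> {1..Suc k}" "a \<noteq> b" "t \<in> T" "t' \<in> T"
    for a b t t'
    using incomplete_array_row[OF A that] by simp
  have ij': "i \<in> {1..Suc k}" "j \<in> {1..Suc k}" "Suc k \<in> {1..Suc k}" "i \<noteq> Suc k" "j \<noteq> Suc k"
    using ij by auto
  consider (TT) t m t' m' where "x = Inl (t, m)" "y = Inl (t', m')" "t \<in> T" "t' \<in> T" "m \<in> M" "m' \<in> M"
    | (TU) t m u where "x = Inl (t, m)" "y = Inr u" "t \<in> T" "m \<in> M" "u \<in> U"
    | (UT) t m u where "y = Inl (t, m)" "x = Inr u" "t \<in> T" "m \<in> M" "u \<in> U"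
    using xy out by (elim PlusE) auto
  then show "\<exists>p\<in>?I. ?W p i = x \<and> ?W p j = y"
  proof cases
    case TT
    obtain r where r: "r \<in> I" "A r i = t" "A r j = t'" using row[OF ij'(1,2) ij(3) TT(3,4)] by blast
    show ?thesis
    proof (cases "A r (Suc k) \<in> U")
      case False
      obtain s where s: "s \<in> J" "B s i = m" "B s j = m'"
        using incomplete_array_row[OF B ij TT(5,6)] by blast
      have "Inl (r, s) \<in> ?I" using r s False by (intro InlI) simp
      moreover have "?W (Inl (r, s)) i = x" "?W (Inl (r, s)) j = y"
        using r s by (simp_all add: wilson_entry_def TT)
      ultimately show ?thesis by blast
    next
      case True
      have mw: "m \<noteq> w" "m' \<noteq> w" using TT w by auto
      then obtain e where e: "e \<in> K" "C e i = m" "C e j = m'"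
        using incomplete_array_row[OF C ij, of m m'] TT(5,6) by blast
      have "Inr (r, e) \<in> ?I" using r e True by (intro InrI) simp
      moreover have "?W (Inr (r, e)) i = x" "?W (Inr (r, e)) j = y"
        using r e mw by (simp_all add: wilson_entry_def TT)
      ultimately show ?thesis by blast
    qed
  next
    case TU
    have m: "m \<noteq> w" "m \<in> insert w M" using TU w by auto
    obtain r where r: "r \<in> I" "A r i = t" "A r (Suc k) = u"
      using row[OF ij'(1,3,4) TU(3)] TU(5) U by blast
    obtain e where e: "e \<in> K" "C e i = m" "C e j = w"
      using incomplete_array_row[OF C ij m(2), of w] m(1) by blast
    have "Inr (r, e) \<in> ?I" using r e TU(5) by (intro InrI) simp
    moreover have "?W (Inr (r, e)) i = x" "?W (Inr (r, e)) j = y"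
      using r e m by (simp_all add: wilson_entry_def TU)
    ultimately show ?thesis by blast
  next
    case UT
    have m: "m \<noteq> w" "m \<in> insert w M" using UT w by auto
    obtain r where r: "r \<in> I" "A r j = t" "A r (Suc k) = u"
      using row[OF ij'(2,3,5) UT(3)] UT(5) U by blast
    obtain e where e: "e \<in> K" "C e i = w" "C e j = m"
      using incomplete_array_row[OF C ij _ m(2), of w] m(1) by blast
    have "Inr (r, e) \<in> ?I" using r e UT(5) by (intro InrI) simp
    moreover have "?W (Inr (r, e)) i = x" "?W (Inr (r, e)) j = y"
      using r e m by (simp_all add: wilson_entry_def UT)
    ultimately show ?thesis by blast
  qed
qed

lemma realises_all_wilson:
  fixes w :: 'm and B :: "'s \<Rightarrow> nat \<Rightarrow> 'b"
  assumes A: "incomplete_array (Suc k) T {} I A" and U: "U \<subseteq> T" "realises_all k U"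
    and B: "incomplete_array k M {} J B"
    and C: "incomplete_array k M' {w} K C" "card M' = Suc (card M)"
    and k: "k \<ge> 2"
    and L: "finite L" "card L = card T * card M + card U"
  shows "realises_all k L"
proof -
  have fin: "finite T" "finite M" "finite M'" and wM: "w \<in> M'"
    using A B C by (auto simp: incomplete_array_def)
  have finU: "finite U" using U(1) fin(1) finite_subset by blast
  have "card (M' - {w}) = card M" using C(2) wM fin by simp
  \<comment> \<open>\<open>B\<close> and \<open>C\<close> come on unrelated alphabets;
    \<open>f\<close> identifies \<open>M\<close> with \<open>M'\<close> minus the point
    \<open>w\<close>.\<close>
  then obtain f where f: "bij_betw f M (M' - {w})"
    using fin by (metis finite_Diff finite_same_card_bij)
  have B': "incomplete_array k (M' - {w}) {} J (\<lambda>r l. f (B r l))"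
    using incomplete_array_map[OF B f] by simp
  have C': "incomplete_array k (insert w (M' - {w})) {w} K C"
    using C(1) wM by (simp add: insert_absorb)
  let ?L = "(T \<times> (M' - {w})) <+> U"
  have "bij_betw Inr U (Inr ` U)" by (simp add: bij_betw_def)
  then have U': "realises_all k (Inr ` U)" by (rule realises_all_alphabet[OF k _ U(2)])
  have "realises_all k ?L"
    by (rule realises_all_fill[OF incomplete_array_wilson[OF A U(1) B' C'] U' k]) simp
  moreover have "card ?L = card L" "finite ?L"
    using fin finU L \<open>card (M' - {w}) = card M\<close> by (simp_all add: card_Plus card_cartesian_product)
  then obtain g where "bij_betw g ?L L" using L(1) finite_same_card_bij by blast
  ultimately show ?thesis using realises_all_alphabet[OF k] by blast
qed

subsection \<open>Arrays from the fields with 4 and 8 elements\<close>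

unbundle bit_operations_syntax

text \<open>
  The elements of a field of order \<open>2\<^sup>d\<close> are the integers below \<open>2\<^sup>d\<close>, with addition \<open>XOR\<close>; the lists
  \<open>ts\<close> are the multiplication tables of \<open>1, \<alpha>, \<alpha>\<^sup>2\<close>, where \<open>\<alpha>\<^sup>2 = \<alpha> + 1\<close> respectively \<open>\<alpha>\<^sup>3 = \<alpha> + 1\<close>.
\<close>

definition field_entry :: "int list list \<Rightarrow> int \<times> int \<Rightarrow> nat \<Rightarrow> int" where
  "field_entry ts = (\<lambda>(x, y) l. if l = 1 then x else if l = 2 then y else x XOR (ts ! (l - 3) ! nat y))"

definition field4_tables :: "int list list" where
  "field4_tables = [[0, 1, 2, 3], [0, 2, 3, 1], [0, 3, 1, 2]]"

definition field8_tables :: "int list list" where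
  "field8_tables = [[0, 1, 2, 3, 4, 5, 6, 7], [0, 2, 4, 6, 3, 1, 7, 5], [0, 4, 3, 7, 6, 2, 5, 1]]"

text \<open>Executable form over lists. Injectivity for \<open>i < j\<close> is the whole content:
  interchanging columns gives the other pairs, and finiteness gives surjectivity.\<close>

definition columns_check :: "int list \<Rightarrow> int list list \<Rightarrow> bool" where
  "columns_check xs ts \<longleftrightarrow>
     list_all (\<lambda>p. list_all (\<lambda>l. field_entry ts p l \<in> set xs) [1, 2, 3, 4, 5]) (List.product xs xs) \<and>
     list_all (\<lambda>(i, j). distinct (map (\<lambda>p. (field_entry ts p i, field_entry ts p j)) (List.product xs xs)))
       [(1, 2), (1, 3), (1, 4), (1, 5), (2, 3), (2, 4), (2, 5), (3, 4), (3, 5), (4, 5)]"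

lemma columns_check_field4: "columns_check [0, 1, 2, 3] field4_tables"
  by code_simp

lemma columns_check_field8: "columns_check [0, 1, 2, 3, 4, 5, 6, 7] field8_tables"
  by code_simp

lemma field_array:
  assumes "columns_check xs ts"
  shows "incomplete_array 5 (set xs) {} (set xs \<times> set xs) (field_entry ts)"
  unfolding incomplete_array_def
proof (intro conjI ballI impI)
  let ?S = "set xs \<times> set xs"
  fix i j :: nat assume ij: "i \<in> {1..5}" "j \<in> {1..5}" "i \<noteq> j"
  have five: "l = 1 \<or> l = 2 \<or> l = 3 \<or> l = 4 \<or> l = 5" if "l \<in> {1..5}" for l :: nat using that by auto
  have inj: "inj_on (\<lambda>p. (field_entry ts p i, field_entry ts p j)) ?S"
    if "i \<in> {1..5}" "j \<in> {1..5}" "i < j" for i j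
  proof -
    have "(i, j) \<in> set [(1, 2), (1, 3), (1, 4), (1, 5), (2, 3), (2, 4), (2, 5), (3, 4), (3, 5), (4, 5)]"
      using five[OF that(1)] five[OF that(2)] that(3) by (elim disjE) simp_all
    then have "distinct (map (\<lambda>p. (field_entry ts p i, field_entry ts p j)) (List.product xs xs))"
      using assms unfolding columns_check_def list_all_iff by (elim conjE, elim ballE) auto
    then show ?thesis by (simp add: distinct_map)
  qed
  have "inj_on (\<lambda>p. (field_entry ts p i, field_entry ts p j)) ?S"
  proof (cases "i < j")
    case False
    then show ?thesis using inj[OF ij(2,1)] ij(3) by (auto simp: inj_on_def)
  qed (use inj[OF ij(1,2)] in blast)
  moreover have "field_entry ts p l \<in> set xs" if "p \<in> ?S" "l \<in> {1..5}" for p l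
    using assms that(1) five[OF that(2)] unfolding columns_check_def by (auto simp: list_all_iff)
  then have "(\<lambda>p. (field_entry ts p i, field_entry ts p j)) ` ?S \<subseteq> ?S" using ij by blast
  ultimately show "bij_betw (\<lambda>p. (field_entry ts p i, field_entry ts p j)) ?S (?S - {} \<times> {})"
    using endo_inj_surj[of ?S] by (simp add: bij_betw_def)
qed auto

lemma field4_array: "\<exists>I A. incomplete_array 5 {0..<4::int} {} (I :: (int \<times> int) set) A"
proof -
  have "set [0, 1, 2, 3] = {0..<4::int}" by auto
  then show ?thesis using field_array[OF columns_check_field4] by metis
qed

text \<open>The row indexed by (0,0) is constantly 0, a subarray of order 1 that can be
  deleted.\<close>

lemma field8_array_hole:
  "\<exists>I A. incomplete_array 5 {0..<8::int} {0} (I :: (int \<times> int) set) A"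
proof -
  have S: "set [0, 1, 2, 3, 4, 5, 6, 7] = {0..<8::int}" by auto
  have zero: "field_entry field8_tables (0, 0) l = 0" if "l \<in> {1..5}" for l :: nat
  proof -
    have "l = 1 \<or> l = 2 \<or> l = 3 \<or> l = 4 \<or> l = 5" using that by auto
    then show ?thesis by (auto simp: field_entry_def field8_tables_def)
  qed
  have "incomplete_array 5 {0..<8::int} {0} ({0..<8} \<times> {0..<8} - {(0, 0)}) (field_entry field8_tables)"
    by (rule incomplete_array_remove[OF field_array[OF columns_check_field8, unfolded S]]) (use zero in auto)
  then show ?thesis by blast
qed

section \<open>Linear arrays in orders coprime to 6\<close>

lemma linear_array_exists:
  fixes m :: int
  assumes "m > 0" "\<And>p. 2 \<le> p \<Longrightarrow> p + 1 < int k \<Longrightarrow> coprime p m"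
  shows "\<exists>I A. incomplete_array k {0..<m} {} (I :: (int \<times> int) set) A"
  by (intro exI, rule linear_array[OF assms(1)], rule det2_standard, rule assms(2))

lemma linear_array_hole_exists:
  fixes m d :: int
  assumes "m > 0" "d dvd m" "\<And>p. 2 \<le> p \<Longrightarrow> p + 1 < int k \<Longrightarrow> coprime p m"
  shows "\<exists>I A. incomplete_array k {0..<m} {x \<in> {0..<m}. d dvd x} (I :: (int \<times> int) set) A"
  by (intro exI, rule linear_array_hole[OF assms(1,2)], rule det2_standard, rule assms(3))

text \<open>The numbers 2, 3, 4 are those that six standard columns require to be
  invertible.\<close>

lemma coprime_6_imp:
  fixes p m :: int
  assumes "coprime m 6" "2 \<le> p" "p + 1 < int 6"
  shows "coprime p m"
proof -
  have m: "coprime 2 m" "coprime 3 m"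
    using coprime_divisors[of 2 6 m m] coprime_divisors[of 3 6 m m] assms(1)
    by (simp_all add: coprime_commute[of 6])
  have "p = 2 \<or> p = 3 \<or> p = 4" using assms(2,3) by auto
  moreover have "coprime 4 m" using m(1) coprime_mult_left_iff[of 2 2 m] by simp
  ultimately show ?thesis using m by auto
qed

lemma realises_all_11_mult:
  fixes w :: int
  assumes w: "coprime w 6" "w > 0"
  shows "realises_all 5 {0..<11 * w}"
proof -
  let ?H = "{x \<in> {0..<11 * w}. w dvd x}"
  have "bij_betw (\<lambda>x. w * x) {0..<11} ?H"
    by (rule bij_betwI[where g = "\<lambda>x. x div w"])
      (use w in \<open>auto simp: mult_less_cancel_left dvd_def zero_le_mult_iff\<close>)
  from realises_all_alphabet[OF _ this realises_all_11] have H: "realises_all 5 ?H" by simp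
  have cop: "coprime p (11 * w)" if "2 \<le> p" "p + 1 < int 5" for p
  proof -
    have "coprime p 11" using that by (intro coprime_11I) simp
    moreover have "coprime p w" using coprime_6_imp[OF w(1)] that by simp
    ultimately show ?thesis by simp
  qed
  obtain I A where "incomplete_array 5 {0..<11 * w} ?H (I :: (int \<times> int) set) A"
    using linear_array_hole_exists[of "11 * w" w 5, OF _ _ cop] w(2) by auto
  from realises_all_fill[OF this H] show ?thesis by simp
qed

subsection \<open>All large orders\<close>

lemma coprime_6I:
  fixes n :: int
  assumes "n mod 6 \<in> {1, 5}"
  shows "coprime n 6"
proof -
  have "gcd (n mod 6) 6 = 1" using assms by (elim insertE emptyE) (simp_all add: gcd_non_0_int)
  then show ?thesis by (simp add: coprime_iff_gcd_eq_1 gcd.commute flip: gcd_red_int)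
qed

text \<open>For t = 1 or 5 modulo 6 the residue of 4 t modulo 24 is 4 or 20; the list of
  \<open>w\<close> consists of the residues modulo 24 coprime to 6.\<close>

lemma odd_residues_mod_24:
  "\<forall>r\<in>set [0..23]. odd r \<longrightarrow> (\<exists>w\<in>set [1, 5, 7, 11, 13, 17, 19, 23]. (r - 11 * w) mod 24 \<in> {4, 20})"
  by code_simp

lemma odd_order_split:
  fixes n :: int
  assumes "odd n" "n \<ge> 4000"
  obtains t w where "w > 0" "coprime w 6" "coprime t 6" "11 * w \<le> t" "n = 4 * t + 11 * w"
proof -
  have "odd (n mod 24)" using assms(1) by (simp add: dvd_mod_iff)
  moreover have "n mod 24 \<in> set [0..23]"
    using pos_mod_bound[of 24 n] by (simp del: pos_mod_bound)
  ultimately obtain w where w: "w \<in> set [1, 5, 7, 11, 13, 17, 19, 23]" "(n mod 24 - 11 * w) mod 24 \<in> {4, 20}"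
    using odd_residues_mod_24 by blast
  define z where "z = n - 11 * w"
  have "z mod 24 \<in> {4, 20}" using w(2) by (simp only: z_def mod_diff_left_eq)
  moreover have "z = 24 * (z div 24) + z mod 24" by simp
  ultimately have "z = 4 * (6 * (z div 24) + 1) \<or> z = 4 * (6 * (z div 24) + 5)"
    by (elim insertE emptyE) simp_all
  then obtain t where t: "z = 4 * t" "t mod 6 \<in> {1, 5}"
    by (elim disjE) (rule that, assumption, simp)+
  have "w mod 6 \<in> {1, 5}" "0 < w" "w \<le> 23" using w(1) by auto
  moreover from this have "11 * w \<le> t" using t(1) assms(2) unfolding z_def by linarith
  moreover have "n = 4 * t + 11 * w" using t(1) by (simp add: z_def)
  ultimately show ?thesis using that[of w t] t(2) coprime_6I by blast
qed

text \<open>Likewise 7 t is 7 or 35 modulo 42, and \<open>w\<close> runs over the residues modulo 42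
  coprime to 6.\<close>

lemma even_residues_mod_42:
  "\<forall>r\<in>set [0..41]. even r \<longrightarrow> (\<exists>w\<in>set [1, 5, 7, 11, 13, 17, 19, 23, 25, 29, 31, 35, 37, 41]. (r - 11 * w) mod 42 \<in> {7, 35})"
  by code_simp

lemma even_order_split:
  fixes n :: int
  assumes "even n" "n \<ge> 4000"
  obtains t w where "w > 0" "coprime w 6" "coprime t 6" "11 * w \<le> t" "n = 7 * t + 11 * w"
proof -
  have "even (n mod 42)" using assms(1) by (simp add: dvd_mod_iff)
  moreover have "n mod 42 \<in> set [0..41]"
    using pos_mod_bound[of 42 n] by (simp del: pos_mod_bound)
  ultimately obtain w where w: "w \<in> set [1, 5, 7, 11, 13, 17, 19, 23, 25, 29, 31, 35, 37, 41]" "(n mod 42 - 11 * w) mod 42 \<in> {7, 35}"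
    using even_residues_mod_42 by blast
  define z where "z = n - 11 * w"
  have "z mod 42 \<in> {7, 35}" using w(2) by (simp only: z_def mod_diff_left_eq)
  moreover have "z = 42 * (z div 42) + z mod 42" by simp
  ultimately have "z = 7 * (6 * (z div 42) + 1) \<or> z = 7 * (6 * (z div 42) + 5)"
    by (elim insertE emptyE) simp_all
  then obtain t where t: "z = 7 * t" "t mod 6 \<in> {1, 5}"
    by (elim disjE) (rule that, assumption, simp)+
  have "w mod 6 \<in> {1, 5}" "0 < w" "w \<le> 41" using w(1) by auto
  \<comment> \<open>With n = 7 t + 11 w this says n \<ge> 88 w. As 88 * 41 = 3608, the bound 4000
    suffices.\<close>
  moreover from this have "11 * w \<le> t" using t(1) assms(2) unfolding z_def by linarith
  moreover have "n = 7 * t + 11 * w" using t(1) by (simp add: z_def)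
  ultimately show ?thesis using that[of w t] t(2) coprime_6I by blast
qed

text \<open>The master array needs a sixth column, whence \<open>t\<close> coprime to 6, and its
  symbols must contain the hole of order \<open>11 * w\<close>, whence
  \<open>11 * w \<le> t\<close>.\<close>

lemma realises_all_order:
  fixes n t w m :: int
  assumes B: "incomplete_array 5 {0..<m} {} (J :: (int \<times> int) set) B"
    and C: "incomplete_array 5 {0..<m + 1} {0} (K :: (int \<times> int) set) C"
    and w: "w > 0" "coprime w 6" and t: "coprime t 6" "11 * w \<le> t" and m: "m > 0"
  shows "realises_all 5 {0..<m * t + 11 * w}"
proof -
  have "t > 0" using w t by linarith
  then obtain I A where A: "incomplete_array 6 {0..<t} {} (I :: (int \<times> int) set) A"
    using linear_array_exists[of t 6] coprime_6_imp[OF t(1)] by auto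
  have "nat (m * t + 11 * w) = nat t * nat m + nat (11 * w)"
    using w m \<open>t > 0\<close> by (simp add: nat_add_distrib nat_mult_distrib mult.commute)
  moreover have "nat (m + 1) = Suc (nat m)" using m by simp
  ultimately show ?thesis
    using A t w m by (intro realises_all_wilson[OF _ _ realises_all_11_mult[OF w(2,1)] B C, of "{0..<t}" I A]) simp_all
qed

text \<open>Both \<open>t\<close> and \<open>w\<close> are odd, so m t + 11 w and m have opposite
  parity: m = 4 serves odd orders and m = 7 even ones. The block orders 5 and 7 are linear, while 4
  and 8 come from fields.\<close>

lemma realises_all_large:
  assumes "n \<ge> 4000"
  shows "realises_all 5 {1..n :: nat}"
proof -
  have "realises_all 5 {0..<int n}"
  proof (cases "even n")
    case False
    obtain t w where tw: "w > 0" "coprime w 6" "coprime t 6" "11 * w \<le> t" "int n = 4 * t + 11 * w"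
    proof (rule odd_order_split[of "int n"])
      show "odd (int n)" "4000 \<le> int n" using False assms by simp_all
    qed blast
    have "coprime p 5" if "2 \<le> p" "p + 1 < int 5" for p :: int
    proof -
      have "p = 2 \<or> p = 3" using that by auto
      then show ?thesis by (auto simp: coprime_iff_gcd_eq_1 gcd_non_0_int)
    qed
    \<comment> \<open>With divisor 5 the hole shrinks to \<open>{0}\<close>.\<close>
    then obtain K C where "incomplete_array 5 {0..<5 :: int} {x \<in> {0..<5}. 5 dvd x} (K :: (int \<times> int) set) C"
      using linear_array_hole_exists[of 5 5 5] by auto
    moreover have "{x \<in> {0..<5}. 5 dvd x} = {0 :: int}" by (auto elim!: dvdE)
    ultimately have C: "incomplete_array 5 {0..<4 + 1 :: int} {0} K C" by simp
    obtain J B where "incomplete_array 5 {0..<4 :: int} {} (J :: (int \<times> int) set) B"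
      using field4_array by blast
    from realises_all_order[OF this C tw(1-4)] show ?thesis using tw(5) by simp
  next
    case True
    obtain t w where tw: "w > 0" "coprime w 6" "coprime t 6" "11 * w \<le> t" "int n = 7 * t + 11 * w"
    proof (rule even_order_split[of "int n"])
      show "even (int n)" "4000 \<le> int n" using True assms by simp_all
    qed blast
    have "coprime p 7" if "2 \<le> p" "p + 1 < int 5" for p :: int
    proof -
      have "p = 2 \<or> p = 3" using that by auto
      then show ?thesis by (auto simp: coprime_iff_gcd_eq_1 gcd_non_0_int)
    qed
    then obtain J B where B: "incomplete_array 5 {0..<7 :: int} {} (J :: (int \<times> int) set) B"
      using linear_array_exists[of 7 5] by auto
    obtain K C where "incomplete_array 5 {0..<7 + 1 :: int} {0} (K :: (int \<times> int) set) C"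
      using field8_array_hole by auto
    from realises_all_order[OF B this tw(1-4)] show ?thesis using tw(5) by simp
  qed
  moreover obtain f where "bij_betw f {0..<int n} {1..n}"
    using finite_same_card_bij[of "{0..<int n}" "{1..n}"] by auto
  ultimately show ?thesis using realises_all_alphabet[of 5] by simp
qed

theorem mainTheorem4:
  shows "\<forall>k\<in>{3, 4, 5}. \<exists>N0. \<forall>n\<ge>N0. calB k n = real (k choose 2) - 1"
proof
  fix k :: nat assume k: "k \<in> {3, 4, 5}"
  have "calB k n = real (k choose 2) - 1" if "n \<ge> 4000" for n
  proof -
    have "realises_all k {1..n}"
      using realises_all_fewer_columns[OF realises_all_large[OF that]] k by auto
    moreover have "k \<ge> 2" using k by auto
    ultimately have "card (tau_parities k {1..n}) = 2 ^ card (basic_triples k)"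
      using card_tau_parities by blast
    then have "calB k n = real (card (basic_triples k))" by (simp add: calB_def log_nat_power)
    then show ?thesis using card_basic_triples[OF k] by simp
  qed
  then show "\<exists>N0. \<forall>n\<ge>N0. calB k n = real (k choose 2) - 1" by blast
qed

end
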